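(* Let $P$ be a $d$-dimensional convex polytope with exactly $2d$ vertices and at most $d^2+1$ edges. Then either $P$ is combinatorially equivalent to the simplicial prism $\Delta_{1,d-1}$ (and hence has exactly $d^2$ edges), or $d=3$.
   Context: Two polytopes are combinatorially equivalent if their face lattices are isomorphic. $\Delta_{1,d-1}$ denotes the Minkowski sum of a line segment and a $(d-1)$-dimensional simplex lying in complementary subspaces (the simplicial prism). *)

theory Defs
  imports "HOL-Analysis.Analysis"
begin

definition vertices_of :: "'a::euclidean_space set \<Rightarrow> 'a set" where
  "vertices_of P = {x. x extreme_point_of P}"

definition edges_of :: "'a::euclidean_space set \<Rightarrow> 'a set set" where
  "edges_of P = {F. F face_of P \<and> aff_dim F = 1}"

definition comb_equiv :: "'a::euclidean_space set \<Rightarrow> 'b::euclidean_space set \<Rightarrow> bool" where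
  "comb_equiv P Q \<longleftrightarrow> (\<exists>f. bij_betw f {F. F face_of P} {G. G face_of Q} \<and>
     (\<forall>F\<in>{F. F face_of P}. \<forall>F'\<in>{F. F face_of P}. F \<subseteq> F' \<longleftrightarrow> f F \<subseteq> f F'))"

definition simplicial_prism :: "nat \<Rightarrow> 'a::euclidean_space set \<Rightarrow> bool" where
  "simplicial_prism d Q \<longleftrightarrow> (\<exists>a b T. a \<noteq> b \<and> (int d - 1) simplex T \<and>
     span {b - a} \<inter> span {x - y | x y. x \<in> T \<and> y \<in> T} = {0} \<and>
     Q = {x + y | x y. x \<in> closed_segment a b \<and> y \<in> T})"

end

theory Submission
  imports Defs
begin

text \<open>
  Every vertex of a \<open>d\<close>-polytope has degree at least \<open>d\<close>, because its neighbours affinely span.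
  With \<open>2d\<close> vertices and at most \<open>d\<^sup>2 + 1\<close> edges the total excess of the degrees over \<open>d\<close> is
  therefore at most 2. If a facet misses \<open>m\<close> vertices, counting the edges that leave it shows
  that the total excess is at least the excess inside the facet plus \<open>(m - 2)(d - m)\<close>. For
  \<open>d \<ge> 4\<close> this leaves, apart from one configuration in dimension 4, only facets that miss 2 or
  \<open>d\<close> vertices, and counting vertex-facet incidences shows that they cannot all miss 2. So some
  facet \<open>A\<close> is a simplex. The facet that meets \<open>A\<close> in all vertices but \<open>a\<close> misses exactly one
  vertex \<open>f a\<close> outside \<open>A\<close>; the small excess forces \<open>f\<close> to be a bijection and \<open>f a\<close> to be the
  only neighbour of \<open>a\<close> outside \<open>A\<close>. Hence the polytope is simple and its facets are those of
  the prism over \<open>A\<close>.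
\<close>

section \<open>Graphs of polytopes with few edges\<close>

text \<open>The bound 2 on the total excess is a handshake count: the degrees add up to at most
  \<open>2 * (d ^ 2 + 1)\<close>, against \<open>2 * d * d\<close> for a \<open>d\<close>-regular
  graph. A facet missing \<open>m\<close> vertices with \<open>2 < m < d\<close> costs at least 1
  through the product \<open>(m - 2) * (d - m)\<close>. A second unit comes from inside the facet:
  no simple polytope of dimension \<open>d - 1\<close> has more than \<open>d\<close> and fewer than
  \<open>2 * (d - 1)\<close> vertices, so some vertex has excess within the facet. This exhausts the
  budget unless the product exceeds 1, and it equals 1 only for \<open>m = 3\<close>,
  \<open>d = 4\<close>. The argument changes dimension, which is why the incidence data form a
  locale: it is interpreted both for the polytope and for its facets. Dimension 3 escapes already at
  \<open>m = 1\<close>: the apex of a pyramid has excess \<open>d - 1\<close>, which is over the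
  budget only from \<open>d = 4\<close> on, and the pyramid over a pentagon has 6 vertices and 10
  edges. Dimensions 1 and 2 are settled directly.\<close>

text \<open>
  The incidence data of a polytope that the counting argument uses: \<open>V\<close> are the vertices,
  \<open>N v\<close> the neighbours of \<open>v\<close>, and \<open>Fs\<close> the vertex sets of the facets.
\<close>

locale polytope_graph =
  fixes V :: "'a set" and N :: "'a \<Rightarrow> 'a set" and Fs :: "'a set set" and d :: nat
  assumes finite_V: "finite V"
    and nbrD: "w \<in> N v \<Longrightarrow> v \<in> V \<and> w \<in> V \<and> w \<noteq> v"
    and nbr_sym: "w \<in> N v \<Longrightarrow> v \<in> N w"
    and facet_subset: "K \<in> Fs \<Longrightarrow> K \<subseteq> V"
    and facet_nonempty: "K \<in> Fs \<Longrightarrow> K \<noteq> {}"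
    and facet_degree: "K \<in> Fs \<Longrightarrow> v \<in> K \<Longrightarrow> d \<le> Suc (card (N v \<inter> K))"
    and facet_out: "K \<in> Fs \<Longrightarrow> v \<in> K \<Longrightarrow> \<exists>w\<in>N v. w \<notin> K"
    and facet_facet_out: "K \<in> Fs \<Longrightarrow> G \<in> Fs \<Longrightarrow> K \<noteq> G \<Longrightarrow> v \<in> K \<Longrightarrow> v \<in> G \<Longrightarrow> \<exists>w\<in>N v \<inter> K. w \<notin> G"
    and simple_facet_unique: "K \<in> Fs \<Longrightarrow> G \<in> Fs \<Longrightarrow> v \<in> K \<Longrightarrow> v \<in> G \<Longrightarrow> card (N v) = d \<Longrightarrow>
      w \<in> N v \<Longrightarrow> w \<notin> K \<Longrightarrow> w \<notin> G \<Longrightarrow> K = G"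
    and vertex_facet: "v \<in> V \<Longrightarrow> w \<in> V \<Longrightarrow> v \<noteq> w \<Longrightarrow> \<exists>K\<in>Fs. v \<in> K \<and> w \<notin> K"
    and edge_facet: "v \<in> N u \<Longrightarrow> w \<in> V \<Longrightarrow> w \<noteq> u \<Longrightarrow> w \<noteq> v \<Longrightarrow> \<exists>K\<in>Fs. u \<in> K \<and> v \<in> K \<and> w \<notin> K"
    and apex: "K \<in> Fs \<Longrightarrow> V - K = {x} \<Longrightarrow> N x = K"
begin

section \<open>Degree bounds and simple vertices\<close>

lemma nbr_subset: "N v \<subseteq> V - {v}"
  using nbrD by blast

lemma finite_nbr [simp]: "finite (N v)"
  using nbr_subset finite_V by (meson finite_Diff finite_subset)

lemma nbr_commute: "w \<in> N v \<longleftrightarrow> v \<in> N w"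
  using nbr_sym by blast

lemma finite_facet: "K \<in> Fs \<Longrightarrow> finite K"
  using facet_subset finite_V finite_subset by blast

lemma finite_Fs: "finite Fs"
  using facet_subset finite_V by (meson Pow_iff finite_Pow_iff finite_subset subsetI)

lemma card_nbr_split: "card (N v) = card (N v \<inter> K) + card (N v - K)"
  using card_Int_Diff[of "N v" K] by simp

lemma degree_ge_in_facet:
  assumes "K \<in> Fs" "v \<in> K"
  shows "d \<le> card (N v)"
proof -
  have "N v - K \<noteq> {}" using facet_out[OF assms] by blast
  hence "card (N v - K) \<ge> 1" by (simp add: Suc_leI card_gt_0_iff)
  thus ?thesis using facet_degree[OF assms] card_nbr_split[of v K] by simp
qed

lemma degree_ge:
  assumes "v \<in> V" "2 \<le> card V"
  shows "d \<le> card (N v)"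
proof -
  have "V \<noteq> {v}" using assms(2) by auto
  then obtain w where "w \<in> V" "v \<noteq> w" using assms(1) by blast
  then show ?thesis using vertex_facet[OF assms(1)] degree_ge_in_facet by blast
qed

lemma card_facet_ge:
  assumes "K \<in> Fs"
  shows "d \<le> card K"
proof -
  obtain v where v: "v \<in> K" using facet_nonempty[OF assms] by blast
  have "N v \<inter> K \<subseteq> K - {v}" using nbr_subset by blast
  hence "card (N v \<inter> K) \<le> card K - 1"
    using card_mono[of "K - {v}" "N v \<inter> K"] finite_facet[OF assms] v by simp
  moreover have "card K > 0" using v finite_facet[OF assms] card_gt_0_iff by blast
  ultimately show ?thesis using facet_degree[OF assms v] by linarith
qed

lemma facet_proper: "K \<in> Fs \<Longrightarrow> K \<subset> V"
  using facet_nonempty facet_out facet_subset nbrD by blast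

text \<open>A facet holds at least \<open>d - 1\<close> neighbours of each of its vertices, which
  leaves a simple vertex only one neighbour to miss. Most later arguments spread membership in a
  facet by this rule: once one missed neighbour is known, all the others are inside.\<close>

lemma simple_misses_one:
  assumes "K \<in> Fs" "v \<in> K" "card (N v) = d" "w \<in> N v" "w \<notin> K" "x \<in> N v" "x \<noteq> w"
  shows "x \<in> K"
proof (rule ccontr)
  assume "x \<notin> K"
  hence "{w, x} \<subseteq> N v - K" using assms by blast
  hence "card {w, x} \<le> card (N v - K)" by (intro card_mono) auto
  thus False using facet_degree[OF assms(1,2)] card_nbr_split[of v K] assms by simp
qed

lemma double_count:
  assumes "K \<subseteq> V" "M \<subseteq> V"
  shows "(\<Sum>v\<in>K. card (N v \<inter> M)) = (\<Sum>u\<in>M. card (N u \<inter> K))"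
proof -
  have fin: "finite K" "finite M" using assms finite_V finite_subset by auto
  have "(\<Sum>v\<in>K. card (N v \<inter> M)) = (\<Sum>v\<in>K. \<Sum>u\<in>M. if u \<in> N v then 1 else 0)"
    using fin by (intro sum.cong) (auto simp: sum.If_cases Int_commute)
  also have "\<dots> = (\<Sum>u\<in>M. \<Sum>v\<in>K. if v \<in> N u then 1 else 0)"
    by (subst sum.swap) (simp add: nbr_commute)
  also have "\<dots> = (\<Sum>u\<in>M. card (N u \<inter> K))"
    using fin by (intro sum.cong) (auto simp: sum.If_cases Int_commute)
  finally show ?thesis .
qed

section \<open>The degree excess counted across a facet\<close>

definition excess :: "'a \<Rightarrow> int" where
  "excess v = int (card (N v)) - int d"

text \<open>The number of edges between \<open>K\<close> and \<open>V - K\<close>, expressed through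
  the degrees in \<open>V - K\<close>, is eliminated from the degree sum;
  \<open>card K = 2 * d - m\<close> turns the constants into the product. The last sum counts
  ordered nonadjacent pairs in \<open>V - K\<close>. When \<open>K\<close> is a facet, none of the
  three sums on the right is negative.\<close>

lemma excess_identity:
  assumes "K \<subseteq> V" and cV: "card V = 2 * d" and m: "card (V - K) = m"
  shows "(\<Sum>v\<in>V. excess v) =
    (\<Sum>v\<in>K. int (card (N v \<inter> K)) - (int d - 1)) + (int m - 2) * (int d - int m)
    + 2 * (\<Sum>v\<in>V - K. excess v) + (\<Sum>v\<in>V - K. int m - 1 - int (card (N v \<inter> (V - K))))"
proof -
  define M where "M = V - K"
  have fin: "finite K" "finite M" using assms(1) finite_V finite_subset unfolding M_def by auto
  have VU: "V = K \<union> M" "K \<inter> M = {}" using assms(1) unfolding M_def by auto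
  have cM: "card M = m" using m M_def by simp
  have cK: "card K + m = 2 * d"
    using cV cM card_Un_disjoint[OF fin VU(2)] VU(1) by metis
  have split: "card (N v) = card (N v \<inter> K) + card (N v \<inter> M)" for v
  proof -
    have "N v - K = N v \<inter> M" using M_def nbr_subset by blast
    thus ?thesis using card_nbr_split[of v K] by simp
  qed
  define s1 where "s1 = (\<Sum>v\<in>K. int (card (N v \<inter> K)))"
  define s2 where "s2 = (\<Sum>v\<in>M. int (card (N v \<inter> M)))"
  define c where "c = (\<Sum>v\<in>K. int (card (N v \<inter> M)))"
  have c': "c = (\<Sum>v\<in>M. int (card (N v \<inter> K)))"
    using double_count[of K M] assms(1) unfolding c_def M_def
    by (metis Diff_subset of_nat_sum)
  have 1: "(\<Sum>v\<in>K. excess v) = s1 + c - int (card K) * int d"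
    unfolding excess_def split s1_def c_def by (simp add: sum.distrib sum_subtractf)
  have 2: "(\<Sum>v\<in>M. excess v) = c + s2 - int m * int d"
    unfolding excess_def split s2_def c' using cM by (simp add: sum.distrib sum_subtractf)
  have 3: "(\<Sum>v\<in>V. excess v) = (\<Sum>v\<in>K. excess v) + (\<Sum>v\<in>M. excess v)"
    unfolding VU(1) using fin VU(2) by (rule sum.union_disjoint)
  have 4: "(\<Sum>v\<in>K. int (card (N v \<inter> K)) - (int d - 1)) = s1 - int (card K) * (int d - 1)"
    unfolding s1_def by (simp add: sum_subtractf)
  have 5: "(\<Sum>v\<in>M. int m - 1 - int (card (N v \<inter> M))) = int m * (int m - 1) - s2"
    unfolding s2_def using cM by (simp add: sum_subtractf)
  have K: "int (card K) = 2 * int d - int m" using cK by linarith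
  show ?thesis unfolding M_def[symmetric] 3 1 2 4 5 K by (simp add: algebra_simps)
qed

text \<open>Each vertex of a facet \<open>K\<close> sends exactly one edge out of it, while each of
  the \<open>m\<close> vertices outside sends at least \<open>d - (m - 1)\<close> edges into it. So
  \<open>m * (d - m + 1) \<le> card K < 2 * d - m\<close>, contrary to
  \<open>(m - 2) * (d - m) \<ge> 0\<close>.\<close>

lemma no_small_simple:
  assumes simple: "\<And>v. v \<in> V \<Longrightarrow> card (N v) = d"
    and lo: "d + 2 \<le> card V" and hi: "card V < 2 * d"
  shows False
proof -
  have "card V \<ge> 2" using lo by simp
  then obtain v w where "v \<in> V" "w \<in> V" "v \<noteq> w"
    by (metis card_le_Suc0_iff_eq finite_V not_less_eq_eq numeral_2_eq_2)
  then obtain K where K: "K \<in> Fs" using vertex_facet by blast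
  define m where "m = card (V - K)"
  have fK: "finite K" and KV: "K \<subseteq> V" using finite_facet[OF K] facet_subset[OF K] by auto
  have cK: "card K + m = card V"
    unfolding m_def using card_Diff_subset[OF fK KV] card_mono[OF finite_V KV] by simp
  have m0: "m \<noteq> 0" using facet_proper[OF K] finite_V unfolding m_def by auto
  \<comment> \<open>With a single vertex outside, that vertex is an apex joined to all of
    \<open>K\<close>; simplicity then leaves only \<open>d + 1\<close> vertices in all.\<close>
  have m1: "m \<noteq> 1"
  proof
    assume "m = 1"
    then obtain x where x: "V - K = {x}" unfolding m_def by (metis card_1_singletonE)
    hence "N x = K" using apex[OF K] by blast
    moreover have "x \<in> V" using x by blast
    ultimately have "card K = d" using simple[of x] by simp
    thus False using cK \<open>m = 1\<close> lo by simp
  qed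
  have one: "card (N v \<inter> (V - K)) = 1" if "v \<in> K" for v
  proof -
    have "N v \<inter> (V - K) = N v - K" using nbr_subset by blast
    moreover have "card (N v - K) > 0" using facet_out[OF K that] by (auto simp: card_gt_0_iff)
    moreover have "card (N v - K) \<le> 1"
      using facet_degree[OF K that] card_nbr_split[of v K] simple[of v] that KV by auto
    ultimately show ?thesis by (metis One_nat_def Suc_leI le_antisym)
  qed
  have "int (card K) = (\<Sum>v\<in>K. int (card (N v \<inter> (V - K))))" using one by simp
  also have "\<dots> = (\<Sum>u\<in>V - K. int (card (N u \<inter> K)))"
    using double_count[of K "V - K"] KV by (metis Diff_subset of_nat_sum)
  also have "\<dots> \<ge> (\<Sum>u\<in>V - K. int d - int m + 1)"
  proof (rule sum_mono)
    fix u assume u: "u \<in> V - K"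
    have "N u - K \<subseteq> (V - K) - {u}" using nbr_subset by blast
    hence "card (N u - K) \<le> m - 1" unfolding m_def
      using card_mono[of "(V - K) - {u}" "N u - K"] finite_V u by simp
    thus "int d - int m + 1 \<le> int (card (N u \<inter> K))"
      using card_nbr_split[of u K] simple[of u] u m0 by simp
  qed
  finally have le: "int m * (int d - int m + 1) \<le> int (card K)" by (simp add: m_def)
  have "int m - 2 \<ge> 0" using m0 m1 by linarith
  moreover have "int d - int m \<ge> 0" using cK card_facet_ge[OF K] hi by linarith
  ultimately have "(int m - 2) * (int d - int m) \<ge> 0" by simp
  hence "int m * (int d - int m + 1) \<ge> 2 * int d - int m"
    by (simp add: algebra_simps)
  thus False using le cK hi by linarith
qed

section \<open>Simple polytopes with a simplex facet\<close>

text \<open>Each of the \<open>d\<close> vertices of \<open>A\<close> needs \<open>d - 1\<close>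
  neighbours in \<open>A\<close>, so the graph on \<open>A\<close> is complete.\<close>

lemma simplex_facet:
  assumes "A \<in> Fs" "card A = d" "a \<in> A"
  shows "N a \<inter> A = A - {a}"
proof (rule card_seteq)
  show "finite (A - {a})" using finite_facet[OF assms(1)] by simp
  show "N a \<inter> A \<subseteq> A - {a}" using nbr_subset by blast
  show "card (A - {a}) \<le> card (N a \<inter> A)"
    using facet_degree[OF assms(1,3)] assms finite_facet[OF assms(1)] by simp
qed

lemma card_compl_facet:
  assumes "A \<in> Fs" "card A = d" "card V = 2 * d"
  shows "card (V - A) = d"
  using assms card_Diff_subset[OF finite_facet facet_subset] by simp

text \<open>The graph consists of two complete graphs joined by a perfect matching \<open>f\<close>.
  Since all vertices are simple, a facet is determined by one of its vertices together with the
  neighbour that this vertex misses, so the facets can be listed.\<close>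

lemma simple_imp_prism_facets:
  assumes simple: "\<And>v. v \<in> V \<Longrightarrow> card (N v) = d" and d: "2 \<le> d" and cV: "card V = 2 * d"
    and A: "A \<in> Fs" and cA: "card A = d"
  shows "\<exists>f. bij_betw f A (V - A) \<and> Fs = {A, V - A} \<union> (\<lambda>a. V - {a, f a}) ` A"
proof -
  define B where "B = V - A"
  have AV: "A \<subseteq> V" and fA: "finite A" using facet_subset[OF A] finite_facet[OF A] by auto
  have cB: "card B = d" and fB: "finite B"
    unfolding B_def using card_compl_facet[OF A cA cV] finite_V by auto
  have adjA: "a' \<in> N a" if "a \<in> A" "a' \<in> A" "a \<noteq> a'" for a a'
    using simplex_facet[OF A cA \<open>a \<in> A\<close>] that by blast
  have "card (N a \<inter> B) = 1" if a: "a \<in> A" for a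
  proof -
    have "N a - A = N a \<inter> B" using nbr_subset B_def by blast
    thus ?thesis using card_nbr_split[of a A] simple[of a] simplex_facet[OF A cA a] a AV cA d fA
      by (simp add: subset_eq)
  qed
  hence "\<forall>a\<in>A. \<exists>b. N a \<inter> B = {b}" by (metis card_1_singletonE)
  then obtain f where f: "\<And>a. a \<in> A \<Longrightarrow> N a \<inter> B = {f a}" by metis
  have le: "card (N b \<inter> B) \<le> d - 1" if "b \<in> B" for b
  proof -
    have "N b \<inter> B \<subseteq> B - {b}" using nbr_subset by blast
    thus ?thesis using card_mono[of "B - {b}"] fB cB that by fastforce
  qed
  \<comment> \<open>For \<open>m = d\<close> the product vanishes, and simplicity together with
    completeness of \<open>A\<close> kills all the rest except the nonadjacency count:
    \<open>B\<close> is complete too.\<close>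
  have "(\<Sum>v\<in>B. int d - 1 - int (card (N v \<inter> B))) = 0"
  proof -
    have "(\<Sum>v\<in>A. int (card (N v \<inter> A)) - (int d - 1)) = 0"
      using simplex_facet[OF A cA] fA cA d by (intro sum.neutral) (simp add: of_nat_diff)
    moreover have "excess v = 0" if "v \<in> V" for v using simple[OF that] by (simp add: excess_def)
    ultimately show ?thesis
      using excess_identity[OF AV cV, of d] cB unfolding B_def by simp
  qed
  moreover have "0 \<le> int d - 1 - int (card (N v \<inter> B))" if "v \<in> B" for v
    using le[OF that] d by linarith
  ultimately have "\<forall>v\<in>B. int d - 1 - int (card (N v \<inter> B)) = 0"
    using sum_nonneg_eq_0_iff[OF fB, of "\<lambda>v. int d - 1 - int (card (N v \<inter> B))"] by blast
  hence eq: "card (N b \<inter> B) = d - 1" if "b \<in> B" for b using that by fastforce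
  have adjB: "b' \<in> N b" if "b \<in> B" "b' \<in> B" "b \<noteq> b'" for b b'
  proof -
    have "N b \<inter> B = B - {b}"
      using nbr_subset fB eq[OF \<open>b \<in> B\<close>] cB that by (intro card_seteq) auto
    thus ?thesis using that by blast
  qed
  have rB: "card (N b \<inter> A) = 1" if "b \<in> B" for b
  proof -
    have "N b - A = N b \<inter> B" using nbr_subset B_def by blast
    moreover have "b \<in> V" using that B_def by blast
    ultimately show ?thesis using card_nbr_split[of b A] simple[of b] eq[OF that] d by simp
  qed
  have fin: "f a \<in> B" "f a \<in> N a" if "a \<in> A" for a using f[OF that] by auto
  have inj: "inj_on f A"
  proof (rule inj_onI)
    fix a a' assume *: "a \<in> A" "a' \<in> A" "f a = f a'"
    hence "{a, a'} \<subseteq> N (f a) \<inter> A" using fin nbr_sym by (metis Int_iff empty_subsetI insert_subset)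
    thus "a = a'" using rB[OF fin(1)[OF \<open>a \<in> A\<close>]] by (metis card_1_singletonE insert_subset singletonD)
  qed
  have "f ` A = B" using fin card_image[OF inj] cA cB fB by (intro card_seteq) auto
  hence bij: "bij_betw f A B" using inj by (simp add: bij_betw_def)
  \<comment> \<open>A facet through some other vertex of \<open>A\<close> that misses
    \<open>a\<close> must be this set: every vertex of \<open>A - {a}\<close> enters it and, having
    missed \<open>a\<close>, brings its partner along. If \<open>f a\<close> were in it as well,
    \<open>a\<close> would be an apex of degree \<open>2 * d - 1\<close>.\<close>
  have G: "V - {a, f a} \<in> Fs" if a: "a \<in> A" for a
  proof -
    have "A \<noteq> {a}" using cA d by auto
    then obtain a' where a': "a' \<in> A" "a' \<noteq> a" using a by blast
    then obtain K where K: "K \<in> Fs" "a' \<in> K" "a \<notin> K" using vertex_facet a AV by blast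
    have 1: "x \<in> K" if "x \<in> A" "x \<noteq> a" for x
    proof (cases "x = a'")
      case False
      show ?thesis
        by (rule simple_misses_one[OF K(1,2) _ _ K(3)])
           (use simple a' AV adjA a that False in auto)
    qed (use K in simp)
    have 2: "f x \<in> K" if "x \<in> A" "x \<noteq> a" for x
      by (rule simple_misses_one[OF K(1) 1[OF that] _ _ K(3)])
         (use simple that AV adjA a fin in \<open>auto simp: B_def\<close>)
    have "f a \<notin> K"
    proof
      assume "f a \<in> K"
      hence "f ` A \<subseteq> K" using 2 by auto
      hence "V - K = {a}" using 1 \<open>f ` A = B\<close> K(3) a AV B_def by auto
      hence "N a = K" using apex K by blast
      moreover have "card K = 2 * d - 1"
        using \<open>V - K = {a}\<close> cV facet_subset[OF K(1)] card_Diff_subset[OF finite_facet[OF K(1)] facet_subset[OF K(1)]]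
          card_mono[OF finite_V facet_subset[OF K(1)]] by simp
      ultimately show False using simple[of a] a AV d by auto
    qed
    moreover have "x \<in> K" if x: "x \<in> V" "x \<noteq> a" "x \<noteq> f a" for x
    proof (cases "x \<in> A")
      case False
      then obtain y where "y \<in> A" "x = f y" using x \<open>f ` A = B\<close> B_def by blast
      thus ?thesis using 2 x(3) by blast
    qed (use 1 x in blast)
    ultimately have "K = V - {a, f a}" using K(3) facet_subset[OF K(1)] by blast
    thus ?thesis using K by simp
  qed
  have uniq: "K = V - {w, f w}" if "K \<in> Fs" "a \<in> K" "a \<in> A" "w \<in> A" "w \<noteq> a" "w \<notin> K" for K a w
    by (rule simple_facet_unique[OF that(1) G[OF that(4)] that(2), of w])
       (use that simple AV adjA fin B_def in \<open>auto\<close>)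
  have BF: "B \<in> Fs"
  proof -
    have "A \<noteq> {}" using cA d by auto
    then obtain a where a: "a \<in> A" by blast
    have "f a \<in> V" "a \<in> V" "f a \<noteq> a" using fin[OF a] a AV B_def by auto
    then obtain K where K: "K \<in> Fs" "f a \<in> K" "a \<notin> K" using vertex_facet by blast
    have "B \<subseteq> K"
    proof
      fix b assume b: "b \<in> B"
      show "b \<in> K"
      proof (cases "b = f a")
        case False
        show ?thesis
          by (rule simple_misses_one[OF K(1,2) _ _ K(3)])
             (use simple fin[OF a] nbr_sym adjB b False a in \<open>auto simp: B_def\<close>)
      qed (use K in simp)
    qed
    \<comment> \<open>A vertex of \<open>A\<close> in \<open>K\<close> would, as \<open>a\<close> is
      missed, force \<open>K = V - {a, f a}\<close>, but \<open>f a\<close> is in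
      \<open>K\<close>.\<close>
    moreover have "K \<inter> A = {}" using uniq[OF K(1) _ _ a _ K(3)] K by blast
    ultimately have "K = B" using facet_subset[OF K(1)] B_def by blast
    thus ?thesis using K by simp
  qed
  have "K \<in> {A, B} \<union> (\<lambda>a. V - {a, f a}) ` A" if K: "K \<in> Fs" for K
  proof (cases "K \<inter> A = {}")
    case True
    hence "K \<subseteq> B" using facet_subset[OF K] B_def by blast
    hence "K = B" using card_facet_ge[OF K] cB fB by (intro card_seteq) auto
    thus ?thesis by simp
  next
    case False
    then obtain a where a: "a \<in> K" "a \<in> A" by blast
    obtain w where w: "w \<in> N a" "w \<notin> K" using facet_out[OF K a(1)] by blast
    show ?thesis
    proof (cases "w \<in> A")
      case True
      thus ?thesis using uniq[OF K a(1,2) True _ w(2)] nbrD[OF w(1)] by blast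
    next
      case False
      have "K = A"
        by (rule simple_facet_unique[OF K A a(1,2) _ w False]) (use simple a AV in auto)
      thus ?thesis by simp
    qed
  qed
  hence "Fs = {A, B} \<union> (\<lambda>a. V - {a, f a}) ` A" using A BF G by blast
  thus ?thesis using bij B_def by (intro exI[of _ f]) simp
qed

section \<open>A simplex facet forces simplicity\<close>

lemma excess_nonneg: "v \<in> V \<Longrightarrow> 2 \<le> card V \<Longrightarrow> 0 \<le> excess v"
  using degree_ge by (simp add: excess_def)

text \<open>An apex is joined to all \<open>2 * d - 1\<close> other vertices, so its excess alone is
  \<open>d - 1 \<ge> 3\<close>.\<close>

lemma no_pyramid:
  assumes "card V = 2 * d" "4 \<le> d" "(\<Sum>v\<in>V. excess v) \<le> 2" "K \<in> Fs"
  shows "V - K \<noteq> {x}"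
proof
  assume x: "V - K = {x}"
  hence "N x = K" using apex assms by blast
  moreover have "card K = 2 * d - 1"
    using x assms(1) card_Diff_subset[OF finite_facet facet_subset, OF assms(4,4)]
      card_mono[OF finite_V facet_subset[OF assms(4)]] by simp
  ultimately have "excess x = int d - 1" using assms(2) by (simp add: excess_def of_nat_diff)
  moreover have "sum excess {x} \<le> sum excess V"
    using x finite_V excess_nonneg assms(1,2) by (intro sum_mono2) auto
  ultimately show False using assms by simp
qed

text \<open>Here the identity says that twice the excess on \<open>B\<close> plus the number of
  ordered nonadjacent pairs in \<open>B\<close> is the total excess. A budget of 2 allows
  \<open>B\<close> one vertex of excess 1 or one nonadjacent pair, never both. The matching argument
  for simple polytopes is rerun around this single defect; once \<open>A\<close> is known to be
  simple, comparing the two expressions for the total removes all excess.\<close>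

lemma simplex_facet_imp_simple:
  assumes d: "4 \<le> d" and cV: "card V = 2 * d" and ex: "(\<Sum>v\<in>V. excess v) \<le> 2"
    and A: "A \<in> Fs" and cA: "card A = d" and v: "v \<in> V"
  shows "card (N v) = d"
proof -
  define B where "B = V - A"
  have V2: "2 \<le> card V" using d cV by simp
  have AV: "A \<subseteq> V" and fA: "finite A" using facet_subset[OF A] finite_facet[OF A] by auto
  have BV: "B \<subseteq> V" using B_def by simp
  have cB: "card B = d" and fB: "finite B"
    unfolding B_def using card_compl_facet[OF A cA cV] finite_V by auto
  have adjA: "a' \<in> N a" if "a \<in> A" "a' \<in> A" "a \<noteq> a'" for a a'
    using simplex_facet[OF A cA \<open>a \<in> A\<close>] that by blast
  have NA: "card (N a) = d - 1 + card (N a \<inter> B)" if a: "a \<in> A" for a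
  proof -
    have "N a - A = N a \<inter> B" using nbr_subset B_def by blast
    thus ?thesis using card_nbr_split[of a A] simplex_facet[OF A cA a] a cA fA by simp
  qed
  have nonemptyB: "N a \<inter> B \<noteq> {}" if "a \<in> A" for a
    using facet_out[OF A that] nbr_subset B_def by blast
  define na where "na b = int d - 1 - int (card (N b \<inter> B))" for b
  have na0: "na b \<ge> 0" if "b \<in> B" for b
  proof -
    have "N b \<inter> B \<subseteq> B - {b}" using nbr_subset by blast
    hence "card (N b \<inter> B) \<le> d - 1" using card_mono[of "B - {b}"] fB cB that by fastforce
    thus ?thesis using d by (simp add: na_def)
  qed
  have na1: "na b \<ge> 1" if "b \<in> B" "b' \<in> B" "b \<noteq> b'" "b' \<notin> N b" for b b'
  proof -
    have "N b \<inter> B \<subseteq> B - {b, b'}" using nbr_subset that by blast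
    hence "card (N b \<inter> B) \<le> card (B - {b, b'})" using fB by (intro card_mono) auto
    also have "\<dots> = d - 2" using that fB cB by (simp add: card_Diff_subset)
    finally show ?thesis using d by (simp add: na_def)
  qed
  have ex0: "excess b \<ge> 0" if "b \<in> B" for b using that BV excess_nonneg V2 by blast
  have tot: "2 * (\<Sum>b\<in>B. excess b) + (\<Sum>b\<in>B. na b) = (\<Sum>v\<in>V. excess v)"
  proof -
    have "(\<Sum>v\<in>A. int (card (N v \<inter> A)) - (int d - 1)) = 0"
      using simplex_facet[OF A cA] fA cA d by (intro sum.neutral) (simp add: of_nat_diff)
    thus ?thesis using excess_identity[OF AV cV, of d] cB unfolding B_def na_def by simp
  qed
  have sub_ex: "(\<Sum>b\<in>S. excess b) \<le> (\<Sum>b\<in>B. excess b)" if "S \<subseteq> B" for S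
    using that fB ex0 by (intro sum_mono2) auto
  have sub_na: "(\<Sum>b\<in>S. na b) \<le> (\<Sum>b\<in>B. na b)" if "S \<subseteq> B" for S
    using that fB na0 by (intro sum_mono2) auto
  have ex_ge: "0 \<le> (\<Sum>b\<in>B. excess b)" and na_ge: "0 \<le> (\<Sum>b\<in>B. na b)"
    using ex0 na0 by (auto intro: sum_nonneg)
  have nonsimple: "excess b \<ge> 1" if "b \<in> B" "card (N b) \<noteq> d" for b
    using ex0[OF that(1)] that(2) by (simp add: excess_def)
  \<comment> \<open>Either all bad pairs share their first vertex or there is only one bad pair up to order.\<close>
  define bad where "bad b b' \<longleftrightarrow> b \<in> B \<and> b' \<in> B \<and> b \<noteq> b' \<and> (card (N b) \<noteq> d \<or> b \<notin> N b')" for b b'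
  have cases: "(\<exists>s. \<forall>b b'. bad b b' \<longrightarrow> b = s) \<or> (\<exists>p q. \<forall>b b'. bad b b' \<longrightarrow> {b, b'} = {p, q})"
  proof (cases "\<exists>p\<in>B. \<exists>q\<in>B. p \<noteq> q \<and> p \<notin> N q")
    case True
    then obtain p q where pq: "p \<in> B" "q \<in> B" "p \<noteq> q" "p \<notin> N q" by blast
    have n: "na p \<ge> 1" "na q \<ge> 1" using na1 pq nbr_commute by metis+
    hence "(\<Sum>b\<in>B. na b) \<ge> 2" using sub_na[of "{p, q}"] pq by simp
    hence e: "(\<Sum>b\<in>B. excess b) = 0" "(\<Sum>b\<in>B. na b) \<le> 2" using tot ex ex_ge by linarith+
    have simpB: "card (N b) = d" if "b \<in> B" for b
      using nonsimple[OF that] sub_ex[of "{b}"] that e by fastforce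
    have third: "c \<in> {p, q}" if "c \<in> B" "na c \<ge> 1" for c
    proof (rule ccontr)
      assume "c \<notin> {p, q}"
      hence "sum na {p, q, c} = na p + (na q + na c)" using pq by (simp add: eq_commute)
      thus False using sub_na[of "{p, q, c}"] that pq n e by simp
    qed
    have "{b, b'} = {p, q}" if "bad b b'" for b b'
    proof -
      have "b \<in> {p, q}" "b' \<in> {p, q}" "b \<noteq> b'"
        using third na1 that simpB nbr_commute unfolding bad_def by metis+
      thus ?thesis by blast
    qed
    thus ?thesis by blast
  next
    case False
    hence adj: "card (N b) \<noteq> d" if "bad b b'" for b b' using that unfolding bad_def by blast
    have "b = c" if "bad b b'" "bad c c'" for b b' c c'
    proof (rule ccontr)
      assume "b \<noteq> c"
      have bc: "b \<in> B" "c \<in> B" using that unfolding bad_def by simp_all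
      have "excess b \<ge> 1" "excess c \<ge> 1" using nonsimple bc adj that by blast+
      hence "(\<Sum>b\<in>B. excess b) \<ge> 2" using sub_ex[of "{b, c}"] bc \<open>b \<noteq> c\<close> by simp
      thus False using tot ex na_ge by linarith
    qed
    thus ?thesis by metis
  qed
  have bad_unique: "b = c \<or> (b = c' \<and> b' = c)" if "bad b b'" "bad c c'" for b b' c c'
    using cases
  proof (elim disjE exE)
    fix p q assume "\<forall>b b'. bad b b' \<longrightarrow> {b, b'} = {p, q}"
    hence "{b, b'} = {c, c'}" using that by metis
    thus ?thesis by (auto simp: doubleton_eq_iff)
  qed (use that in blast)
  \<comment> \<open>A nonadjacent pair uses up the whole budget with one unit at each end; in its
    absence only the excess counts, and it counts double.\<close>
  have r2: "card (N b \<inter> A) \<le> 2" if b: "b \<in> B" for b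
  proof -
    have "N b - A = N b \<inter> B" using nbr_subset B_def by blast
    hence "int (card (N b \<inter> A)) = 1 + excess b + na b"
      using card_nbr_split[of b A] unfolding excess_def na_def by simp
    moreover have "excess b + na b \<le> 1"
    proof (cases "\<exists>b'\<in>B. b \<noteq> b' \<and> b' \<notin> N b")
      case True
      then obtain b' where b': "b' \<in> B" "b \<noteq> b'" "b' \<notin> N b" by blast
      hence "na b' \<ge> 1" using na1 b nbr_commute by metis
      thus ?thesis using sub_na[of "{b, b'}"] sub_ex[of "{b}"] b b' na1[OF b b'] ex0[OF b] tot ex by auto
    next
      case False
      hence "N b \<inter> B = B - {b}" using nbr_subset[of b] by auto
      hence "na b = 0" using fB cB b d by (simp add: na_def of_nat_diff)
      thus ?thesis using sub_ex[of "{b}"] b tot ex na_ge by simp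
    qed
    ultimately show ?thesis by linarith
  qed
  have exG: "\<exists>G\<in>Fs. \<exists>b\<in>B. G = V - {a, b}" if a: "a \<in> A" for a
  proof -
    \<comment> \<open>Otherwise \<open>A - {a}\<close> would hold at least three vertices of
      positive excess.\<close>
    have "\<exists>a'\<in>A - {a}. card (N a') = d"
    proof (rule ccontr)
      assume neg: "\<not> ?thesis"
      have "(\<Sum>x\<in>A - {a}. 1) \<le> (\<Sum>x\<in>A - {a}. excess x)"
      proof (rule sum_mono)
        fix x assume "x \<in> A - {a}"
        thus "1 \<le> excess x" using neg excess_nonneg[of x] AV V2 by (force simp: excess_def)
      qed
      also have "\<dots> \<le> (\<Sum>x\<in>V. excess x)"
        using finite_V AV excess_nonneg V2 by (intro sum_mono2) auto
      finally show False using ex a cA fA d by simp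
    qed
    then obtain a' where a': "a' \<in> A" "a' \<noteq> a" "card (N a') = d" by blast
    then obtain G where G: "G \<in> Fs" "a' \<in> G" "a \<notin> G" using vertex_facet a AV by blast
    have inG: "x \<in> G" if "x \<in> A" "x \<noteq> a" for x
    proof (cases "x = a'")
      case False
      show ?thesis
        by (rule simple_misses_one[OF G(1,2) a'(3) _ G(3)]) (use a' AV adjA a that False in auto)
    qed (use G in simp)
    have nbrG: "N x \<inter> (G \<inter> B) \<noteq> {}" if x: "x \<in> A" "x \<noteq> a" for x
    proof
      assume "N x \<inter> (G \<inter> B) = {}"
      hence "N x \<inter> G \<subseteq> A - {a, x}" using nbr_subset G(3) B_def by blast
      hence "card (N x \<inter> G) \<le> card (A - {a, x})" using fA by (intro card_mono) auto
      also have "\<dots> = d - 2" using x a cA fA by (simp add: card_Diff_subset)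
      finally show False using facet_degree[OF G(1) inG[OF x]] d by simp
    qed
    \<comment> \<open>All \<open>d - 1\<close> vertices of \<open>A - {a}\<close> need a neighbour
      in \<open>G \<inter> B\<close>, and a vertex of \<open>B\<close> serves at most two of them;
      as \<open>d \<ge> 4\<close>, one is not enough.\<close>
    have two: "2 \<le> card (G \<inter> B)"
    proof -
      have "A - {a} \<subseteq> (\<Union>b\<in>G \<inter> B. N b \<inter> A)" using nbrG nbr_commute by blast
      hence "card (A - {a}) \<le> card (\<Union>b\<in>G \<inter> B. N b \<inter> A)"
        using fA fB by (intro card_mono) auto
      also have "\<dots> \<le> (\<Sum>b\<in>G \<inter> B. card (N b \<inter> A))" using fB by (intro card_UN_le) auto
      also have "\<dots> \<le> (\<Sum>b\<in>G \<inter> B. 2)" using r2 by (intro sum_mono) auto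
      finally show ?thesis using d cA fA a by simp
    qed
    then obtain p q where pq: "p \<in> G \<inter> B" "q \<in> G \<inter> B" "p \<noteq> q"
      using card_le_Suc0_iff_eq[of "G \<inter> B"] fB by (auto simp: not_less_eq_eq numeral_2_eq_2)
    have ne: "\<not> B \<subseteq> G"
    proof
      assume "B \<subseteq> G"
      hence "V - G = {a}" using inG G(3) a AV B_def by blast
      thus False using no_pyramid[OF cV d ex G(1)] by blast
    qed
    \<comment> \<open>A simple vertex cannot miss two neighbours, so if \<open>G\<close> missed two
      vertices of \<open>B\<close>, every vertex of \<open>G \<inter> B\<close> would start a bad
      pair ending outside \<open>G\<close>. Two such vertices, \<open>p\<close> and
      \<open>q\<close>, contradict \<open>bad_unique\<close>.\<close>
    have uniq: "b = b'" if b: "b \<in> B - G" "b' \<in> B - G" for b b'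
    proof (rule ccontr)
      assume neq: "b \<noteq> b'"
      have "bad x b \<or> bad x b'" if x: "x \<in> G \<inter> B" for x
      proof (rule ccontr)
        assume "\<not> ?thesis"
        hence "card (N x) = d" "b \<in> N x" "b' \<in> N x"
          using x b nbr_commute unfolding bad_def by blast+
        thus False using simple_misses_one[of G x b b'] G x b neq by blast
      qed
      then obtain y z where "bad p y" "bad q z" "y \<notin> G" "z \<notin> G" using pq b by (metis DiffD2)
      thus False using bad_unique pq by blast
    qed
    obtain b where b: "b \<in> B" "b \<notin> G" using ne by blast
    have "G = V - {a, b}"
    proof
      show "G \<subseteq> V - {a, b}" using facet_subset[OF G(1)] G(3) b by blast
      show "V - {a, b} \<subseteq> G"
      proof
        fix x assume "x \<in> V - {a, b}"
        then show "x \<in> G" using inG uniq b unfolding B_def by blast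
      qed
    qed
    thus ?thesis using G b by blast
  qed
  then obtain f where f: "\<And>a. a \<in> A \<Longrightarrow> f a \<in> B \<and> V - {a, f a} \<in> Fs" by metis
  \<comment> \<open>A simple \<open>b\<close> adjacent to \<open>f a\<close> already misses
    \<open>f a\<close> in the facet \<open>V - {a, f a}\<close>, so it cannot also miss
    \<open>a\<close>.\<close>
  have bad_nbr: "bad b (f a)" if "a \<in> A" "b \<in> N a" "b \<in> B" "b \<noteq> f a" for a b
  proof (rule ccontr)
    assume "\<not> ?thesis"
    hence s: "card (N b) = d" "f a \<in> N b" using that f nbr_commute unfolding bad_def by blast+
    have "a \<in> V - {a, f a}"
      by (rule simple_misses_one[of _ b "f a"])
         (use s f[OF that(1)] that B_def nbr_sym in \<open>auto\<close>)
    thus False by simp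
  qed
  have good: "\<exists>b'\<in>B. b' \<noteq> b \<and> \<not> bad b' b" if b: "b \<in> B" for b
  proof (rule ccontr)
    assume "\<not> ?thesis"
    hence "bad x b" if "x \<in> B - {b}" for x using that by blast
    hence "x = y" if "x \<in> B - {b}" "y \<in> B - {b}" for x y using bad_unique that by blast
    hence "card (B - {b}) \<le> Suc 0" using fB card_le_Suc0_iff_eq[of "B - {b}"] by simp
    thus False using b cB fB d by simp
  qed
  \<comment> \<open>A simple neighbour of the common value lies in both facets and misses that value
    in each, so the facets coincide.\<close>
  have inj: "inj_on f A"
  proof (rule inj_onI, rule ccontr)
    fix a a' assume *: "a \<in> A" "a' \<in> A" "f a = f a'" "a \<noteq> a'"
    obtain b where b: "b \<in> B" "b \<noteq> f a" "\<not> bad b (f a)" using good f * by blast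
    hence s: "card (N b) = d" "f a \<in> N b" using f * nbr_commute unfolding bad_def by blast+
    have "V - {a, f a} = V - {a', f a'}"
      by (rule simple_facet_unique[of _ _ b "f a"])
         (use s f[OF *(1)] f[OF *(2)] b * B_def in auto)
    thus False using * AV f B_def by blast
  qed
  have fimg: "f ` A = B" using f card_image[OF inj] cA cB fB by (intro card_seteq) auto
  have matched: "N a \<inter> B = {f a}" if a: "a \<in> A" for a
  proof -
    have "b = f a" if b: "b \<in> N a" "b \<in> B" for b
    proof (rule ccontr)
      assume neq: "b \<noteq> f a"
      obtain a' where a': "a' \<in> A" "b = f a'" using b fimg by blast
      have aa': "a' \<noteq> a" using a' neq by blast
      have badb: "bad b (f a)" using bad_nbr a b neq by blast
      \<comment> \<open>A second neighbour of \<open>x\<close> in \<open>B\<close> could only be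
        \<open>b\<close> again. If there is just one bad pair, the second entries \<open>f x\<close>
        and \<open>f a\<close> clash; if all bad pairs start at \<open>b\<close>, then
        \<open>a'\<close> is joined to \<open>b\<close> as well, and \<open>b\<close> has three
        neighbours in \<open>A\<close>, against \<open>r2\<close>.\<close>
      have others: "N x \<inter> B = {f x}" if x: "x \<in> A" "x \<noteq> a" "x \<noteq> a'" for x
      proof -
        have "c = f x" if c: "c \<in> N x" "c \<in> B" for c
        proof (rule ccontr)
          assume "c \<noteq> f x"
          hence badc: "bad c (f x)" using bad_nbr x c by blast
          have fx: "f x \<noteq> f a" "f x \<noteq> b" using inj x a a' by (auto dest: inj_onD)
          hence cb: "c = b" using bad_unique[OF badc badb] by blast
          from cases show False
          proof
            assume "\<exists>p q. \<forall>b b'. bad b b' \<longrightarrow> {b, b'} = {p, q}"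
            hence "{c, f x} = {b, f a}" using badc badb by metis
            thus False using fx cb by (auto simp: doubleton_eq_iff)
          next
            assume "\<exists>s. \<forall>b b'. bad b b' \<longrightarrow> b = s"
            then obtain s where s: "\<And>b b'. bad b b' \<Longrightarrow> b = s" by blast
            have "N a' \<inter> B \<subseteq> {b}" using bad_nbr[OF a'(1)] s badb a'(2) unfolding bad_def by blast
            hence "b \<in> N a'" using nonemptyB[OF a'(1)] by blast
            hence "{a, a', x} \<subseteq> N b \<inter> A" using a a' x b c cb nbr_sym by blast
            hence "card {a, a', x} \<le> card (N b \<inter> A)" by (intro card_mono) auto
            thus False using r2[OF b(2)] aa' x by simp
          qed
        qed
        thus ?thesis using nonemptyB[OF x(1)] by blast
      qed
      \<comment> \<open>A facet containing \<open>a\<close> and \<open>b\<close> but not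
        \<open>a'\<close> meets \<open>A\<close> only in \<open>a\<close>: any other vertex of
        \<open>A\<close> in it is simple and would force \<open>K = V - {a', b}\<close>. This leaves
        \<open>a\<close> at most two neighbours in \<open>K\<close>, fewer than
        \<open>d - 1\<close>.\<close>
      have "a' \<in> V" "a' \<noteq> b" using a'(1) AV b(2) B_def by auto
      then obtain K where K: "K \<in> Fs" "a \<in> K" "b \<in> K" "a' \<notin> K"
        using edge_facet[OF b(1) _ aa'] by blast
      have KA: "x = a" if x: "x \<in> K" "x \<in> A" for x
      proof (rule ccontr)
        assume "x \<noteq> a"
        moreover have "x \<noteq> a'" using x K by blast
        ultimately have "card (N x) = d" using NA[OF x(2)] others[OF x(2)] d by simp
        hence "K = V - {a', f a'}"
          by (intro simple_facet_unique[of _ _ x a'])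
             (use K f a' x AV adjA B_def \<open>x \<noteq> a'\<close> in auto)
        thus False using K a' by blast
      qed
      have "N a \<inter> K \<subseteq> {f a, b}"
      proof
        fix c assume c: "c \<in> N a \<inter> K"
        hence "c \<in> B" using KA nbr_subset[of a] facet_subset[OF K(1)] B_def by blast
        hence "c = f a \<or> bad c (f a)" using bad_nbr a c by blast
        thus "c \<in> {f a, b}" using bad_unique badb by blast
      qed
      hence "card (N a \<inter> K) \<le> card {f a, b}" by (intro card_mono) auto
      also have "\<dots> \<le> 2" by (simp add: card_insert_if)
      finally show False using facet_degree[OF K(1,2)] d by simp
    qed
    thus ?thesis using nonemptyB[OF a] by blast
  qed
  have sA: "excess a = 0" if "a \<in> A" for a
    using NA[OF that] matched[OF that] d by (simp add: excess_def of_nat_diff)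
  \<comment> \<open>Without excess on \<open>A\<close>, the total equals the excess on
    \<open>B\<close>, which \<open>tot\<close> counts twice.\<close>
  have "(\<Sum>v\<in>V. excess v) = (\<Sum>v\<in>A. excess v) + (\<Sum>v\<in>B. excess v)"
    unfolding B_def using sum.subset_diff[OF AV finite_V, of excess] by simp
  hence "(\<Sum>v\<in>B. excess v) = 0" using sA tot na_ge ex_ge by simp
  hence "excess b = 0" if "b \<in> B" for b
    using that sum_nonneg_eq_0_iff[OF fB, of excess] ex0 by blast
  hence "excess v = 0" using sA v B_def by blast
  thus ?thesis by (simp add: excess_def)
qed

section \<open>Vertex-facet incidences\<close>

text \<open>Sending a facet at \<open>v\<close> to the one neighbour of \<open>v\<close> that it
  misses is a bijection onto \<open>N v\<close>.\<close>

lemma card_facets_at_simple: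
  assumes v: "v \<in> V" "card (N v) = d"
  shows "card {K \<in> Fs. v \<in> K} = d"
proof -
  have miss: "\<exists>!w. w \<in> N v \<and> w \<notin> K" if "K \<in> Fs" "v \<in> K" for K
    using facet_out[OF that] simple_misses_one[OF that v(2)] by blast
  define g where "g K = (THE w. w \<in> N v \<and> w \<notin> K)" for K
  have g: "g K \<in> N v \<and> g K \<notin> K" if "K \<in> Fs" "v \<in> K" for K
    unfolding g_def by (rule theI'[OF miss[OF that]])
  have "bij_betw g {K \<in> Fs. v \<in> K} (N v)"
    unfolding bij_betw_def
  proof
    show "inj_on g {K \<in> Fs. v \<in> K}"
      by (rule inj_onI) (metis (mono_tags, lifting) g mem_Collect_eq simple_facet_unique v(2))
    show "g ` {K \<in> Fs. v \<in> K} = N v"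
    proof
      show "g ` {K \<in> Fs. v \<in> K} \<subseteq> N v" using g by blast
      show "N v \<subseteq> g ` {K \<in> Fs. v \<in> K}"
      proof
        fix w assume w: "w \<in> N v"
        obtain K where K: "K \<in> Fs" "v \<in> K" "w \<notin> K" using vertex_facet[OF v(1)] nbrD[OF w] by blast
        hence "g K = w" using miss g w by blast
        thus "w \<in> g ` {K \<in> Fs. v \<in> K}" using K by blast
      qed
    qed
  qed
  thus ?thesis using bij_betw_same_card v(2) by metis
qed

text \<open>If all facets missed two vertices, the numbers \<open>miss v\<close> would add up to
  \<open>2 * card Fs\<close>. The simple vertices, at least \<open>2 * d - 2\<close> of them, are
  each missed by \<open>g = card Fs - d\<close> facets, and the sum is small enough to force
  \<open>g = 1\<close>. But then distinct simple vertices are missed by distinct facets, which needs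
  \<open>2 * d - 2 \<le> d + 1\<close>.\<close>

lemma facet_missing_not_two:
  assumes d: "4 \<le> d" and cV: "card V = 2 * d" and ex: "(\<Sum>v\<in>V. excess v) \<le> 2"
  shows "\<exists>K\<in>Fs. card (V - K) \<noteq> 2"
proof (rule ccontr)
  assume "\<not> ?thesis"
  hence two: "card (V - K) = 2" if "K \<in> Fs" for K using that by blast
  define miss where "miss v = card {K \<in> Fs. v \<notin> K}" for v
  define S where "S = {v \<in> V. card (N v) = d}"
  have V2: "2 \<le> card V" using d cV by simp
  have cS: "2 * d - 2 \<le> card S"
  proof -
    have "int (card (V - S)) = (\<Sum>v\<in>V - S. 1)" by simp
    also have "\<dots> \<le> (\<Sum>v\<in>V - S. excess v)"
    proof (rule sum_mono)
      fix v assume "v \<in> V - S"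
      thus "1 \<le> excess v" using degree_ge[of v] V2 by (auto simp: S_def excess_def)
    qed
    also have "\<dots> \<le> (\<Sum>v\<in>V. excess v)"
      using finite_V excess_nonneg V2 by (intro sum_mono2) auto
    finally have "card (V - S) \<le> 2" using ex by simp
    moreover have "card (V - S) = card V - card S"
      using finite_V by (intro card_Diff_subset) (auto simp: S_def)
    ultimately show ?thesis using cV by simp
  qed
  have SV: "S \<subseteq> V" and fS: "finite S" using finite_V by (auto simp: S_def)
  have total: "(\<Sum>v\<in>V. miss v) = 2 * card Fs"
  proof -
    have "(\<Sum>v\<in>V. miss v) = (\<Sum>v\<in>V. \<Sum>K\<in>Fs. if v \<notin> K then 1 else 0)"
      unfolding miss_def using finite_Fs by (intro sum.cong) (auto simp: sum.If_cases Int_def)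
    also have "\<dots> = (\<Sum>K\<in>Fs. \<Sum>v\<in>V. if v \<notin> K then 1 else 0)" by (rule sum.swap)
    also have "\<dots> = (\<Sum>K\<in>Fs. card (V - K))"
      using finite_V by (intro sum.cong) (auto simp: sum.If_cases Int_def set_diff_eq)
    also have "\<dots> = 2 * card Fs" using two by simp
    finally show ?thesis .
  qed
  have miss_simple: "card Fs = d + miss v" if "v \<in> S" for v
  proof -
    have "Fs = {K \<in> Fs. v \<in> K} \<union> {K \<in> Fs. v \<notin> K}" by blast
    hence "card Fs = card {K \<in> Fs. v \<in> K} + card {K \<in> Fs. v \<notin> K}"
      using finite_Fs by (metis (no_types, lifting) card_Un_disjoint disjoint_iff finite_Un mem_Collect_eq)
    thus ?thesis using card_facets_at_simple[of v] that by (simp add: S_def miss_def)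
  qed
  have miss1: "1 \<le> miss v" if v: "v \<in> V" for v
  proof -
    have "V \<noteq> {v}" using V2 by auto
    then obtain w where "w \<in> V" "v \<noteq> w" using v by blast
    then obtain K where "K \<in> Fs" "v \<notin> K" using vertex_facet v by blast
    thus ?thesis unfolding miss_def using finite_Fs by (auto simp: Suc_le_eq card_gt_0_iff)
  qed
  have "S \<noteq> {}" using cS d by auto
  then obtain v0 where v0: "v0 \<in> S" by blast
  define g where "g = miss v0"
  have g1: "1 \<le> g" using miss1 v0 SV g_def by blast
  have f: "card Fs = d + g" using miss_simple[OF v0] g_def by simp
  have missS: "miss v = g" if "v \<in> S" for v using miss_simple[OF that] f by simp
  have "(\<Sum>v\<in>V. miss v) = (\<Sum>v\<in>V - S. miss v) + (\<Sum>v\<in>S. miss v)"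
    by (rule sum.subset_diff[OF SV finite_V])
  moreover have "(\<Sum>v\<in>S. miss v) = card S * g" using missS by simp
  moreover have "card (V - S) \<le> (\<Sum>v\<in>V - S. miss v)"
    using sum_mono[of "V - S" "\<lambda>_. 1" miss] miss1 by simp
  ultimately have "card (V - S) + card S * g \<le> (\<Sum>v\<in>V. miss v)" by simp
  hence ineq: "card (V - S) + card S * g \<le> 2 * (d + g)" unfolding total f .
  have "card (V - S) = 2 * d - card S" "card S \<le> 2 * d"
    using card_Diff_subset[OF fS SV] card_mono[OF finite_V SV] cV by auto
  hence ineq': "2 * d + card S * g \<le> 2 * (d + g) + card S" using ineq by linarith
  \<comment> \<open>\<open>ineq'\<close> amounts to \<open>card S * (g - 1) \<le> 2 * g\<close>,
    impossible for \<open>g \<ge> 2\<close> because \<open>card S \<ge> 6\<close>.\<close>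
  have "g < 2"
  proof (rule ccontr)
    assume "\<not> g < 2"
    then obtain h where h: "g = 2 + h" using le_Suc_ex[of 2 g] by (auto simp: not_less)
    have "card S * h + card S \<le> 2 * h + 4" using ineq' unfolding h by (simp add: algebra_simps)
    moreover have "2 * h \<le> card S * h" using cS d by (intro mult_le_mono1) linarith
    ultimately show False using cS d by linarith
  qed
  hence g: "g = 1" using g1 by simp
  have "\<forall>v\<in>S. \<exists>K. {K \<in> Fs. v \<notin> K} = {K}"
    using missS g unfolding miss_def by (metis card_1_singletonE)
  then obtain k where k: "\<And>v. v \<in> S \<Longrightarrow> {K \<in> Fs. v \<notin> K} = {k v}" by metis
  have kF: "k ` S \<subseteq> Fs" using k by blast
  have "inj_on k S"
  proof (rule inj_onI, rule ccontr)
    fix v w assume *: "v \<in> S" "w \<in> S" "k v = k w" "v \<noteq> w"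
    then obtain K where K: "K \<in> Fs" "v \<in> K" "w \<notin> K" using vertex_facet SV by blast
    hence "K = k w" using k[OF *(2)] by blast
    moreover have "v \<notin> k v" using k[OF *(1)] by blast
    ultimately show False using K *(3) by simp
  qed
  hence "card S \<le> card Fs" using card_inj_on_le[OF _ kF finite_Fs] by blast
  thus False using f g cS d by linarith
qed

section \<open>The exceptional configuration in dimension 4\<close>

text \<open>
  In dimension 4 a facet that misses 3 vertices is a pyramid with apex \<open>z\<close> over the quadrilateral
  \<open>q1 q2 q3 q4\<close>, and the missed vertices \<open>u1, u2, u3\<close> form a triangle. Up to symmetry \<open>u1\<close> is
  joined to \<open>q1\<close> and \<open>q3\<close>, or to \<open>q1\<close> and \<open>q2\<close>; these are the two cases.
\<close>

lemma wheel_facet_impossible: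
  assumes d: "d = 4" and V: "V = {z, q1, q2, q3, q4, u1, u2, u3}"
    and dist: "distinct [z, q1, q2, q3, q4, u1, u2, u3]"
    and K: "K \<in> Fs" "K = {z, q1, q2, q3, q4}"
    and Nq: "N q1 \<inter> K = {z, q2, q4}" "N q2 = {z, q1, q3, u2}"
    and Nu1: "N u1 = {u2, u3, q1, q3}" and Nu2: "N u2 = {u1, u3, q2, q4}"
    and Nq4: "N q4 = {z, q1, q3, u2}"
  shows False
proof -
  have s: "card (N q2) = d" "card (N q4) = d" "card (N u1) = d" "card (N u2) = d"
    unfolding Nq Nq4 Nu1 Nu2 d using dist by auto
  have side: "\<exists>G\<in>Fs. x \<in> G \<and> y \<notin> G \<and> u1 \<in> G \<and> q3 \<notin> G"
    if xy: "(x = q2 \<and> y = q4) \<or> (x = q4 \<and> y = q2)" for x y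
  proof -
    have Nx: "N x = {z, q1, q3, u2}" using xy Nq Nq4 by auto
    have cx: "card (N x) = d" using s xy by auto
    have "x \<in> V" "q3 \<in> V" "x \<noteq> q3" using xy V dist by auto
    then obtain G where G: "G \<in> Fs" "x \<in> G" "q3 \<notin> G" using vertex_facet by blast
    have in1: "w \<in> G" if "w \<in> {z, q1, u2}" for w
      by (rule simple_misses_one[OF G(1,2) cx _ G(3)]) (use that Nx dist in auto)
    have "K \<noteq> G" using K(2) G(3) by auto
    then obtain w where "w \<in> N q1 \<inter> K" "w \<notin> G"
      using facet_facet_out[OF K(1) G(1), of q1] in1 K(2) by blast
    hence y: "y \<notin> G" using Nq(1) in1 G(2) xy by auto
    have "u1 \<in> G"
      by (rule simple_misses_one[OF G(1) in1 s(4) _ y]) (use Nu2 dist xy in auto)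
    thus ?thesis using G y by blast
  qed
  obtain G where G: "G \<in> Fs" "q2 \<in> G" "u1 \<in> G" "q3 \<notin> G" using side[of q2 q4] by blast
  obtain H where H: "H \<in> Fs" "q2 \<notin> H" "u1 \<in> H" "q3 \<notin> H" using side[of q4 q2] by blast
  \<comment> \<open>Both facets contain the simple vertex \<open>u1\<close> and miss its neighbour
    \<open>q3\<close>, yet only one of them contains \<open>q2\<close>.\<close>
  have "G = H"
    by (rule simple_facet_unique[OF G(1) H(1) G(3) H(3) s(3) _ G(4) H(4)]) (use Nu1 in simp)
  thus False using G H by blast
qed

text \<open>The facet through \<open>q3\<close> that misses \<open>q2\<close> has no room beyond
  \<open>z, q3, q4, u2\<close>: \<open>q4\<close> must lose a neighbour, which can only be
  \<open>q1\<close>; then \<open>u1\<close>, and after it \<open>u3\<close>, would miss two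
  neighbours.\<close>

lemma wheel_facet_imp_simplex_facet:
  assumes d: "d = 4" and V: "V = {z, q1, q2, q3, q4, u1, u2, u3}"
    and dist: "distinct [z, q1, q2, q3, q4, u1, u2, u3]"
    and Nq3: "N q3 = {z, q2, q4, u2}" and Nq4: "N q4 = {z, q1, q3, u2}"
    and Nu1: "N u1 = {u2, u3, q1, q2}" and Nu3: "N u3 = {u1, u2, z, q1}"
  shows "\<exists>G\<in>Fs. card G = d"
proof -
  have s: "card (N q3) = d" "card (N q4) = d" "card (N u1) = d" "card (N u3) = d"
    unfolding Nq3 Nq4 Nu1 Nu3 d using dist by auto
  have "q3 \<in> V" "q2 \<in> V" "q3 \<noteq> q2" using V dist by auto
  then obtain G where G: "G \<in> Fs" "q3 \<in> G" "q2 \<notin> G" using vertex_facet by blast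
  have in1: "w \<in> G" if "w \<in> {z, q4, u2}" for w
    by (rule simple_misses_one[OF G(1,2) s(1) _ G(3)]) (use that Nq3 dist in auto)
  obtain w where "w \<in> N q4" "w \<notin> G" using facet_out[OF G(1), of q4] in1 by blast
  hence q1: "q1 \<notin> G" using Nq4 in1 G(2) by auto
  have u1: "u1 \<notin> G"
  proof
    assume "u1 \<in> G"
    have "q1 \<in> G"
      by (rule simple_misses_one[OF G(1) \<open>u1 \<in> G\<close> s(3) _ G(3)]) (use Nu1 dist in auto)
    thus False using q1 by simp
  qed
  have u3: "u3 \<notin> G"
  proof
    assume "u3 \<in> G"
    have "u1 \<in> G"
      by (rule simple_misses_one[OF G(1) \<open>u3 \<in> G\<close> s(4) _ q1]) (use Nu3 dist in auto)
    thus False using u1 by simp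
  qed
  have "G \<subseteq> {z, q3, q4, u2}" using facet_subset[OF G(1)] V G q1 u1 u3 by blast
  hence "card G \<le> card {z, q3, q4, u2}" by (intro card_mono) auto
  also have "\<dots> = 4" using dist by auto
  finally show ?thesis using card_facet_ge[OF G(1)] d G(1) by (intro bexI[of _ G]) auto
qed

text \<open>The product is 1 and the nonsimple facet takes the other unit, so everything else in the
  identity is tight: one vertex \<open>z\<close> has one extra edge inside \<open>K\<close>, and the
  three missed vertices are simple and pairwise adjacent. The graph can then be reconstructed up to
  symmetry.\<close>

lemma pyramid_facet_imp_simplex_facet:
  assumes d: "d = 4" and cV: "card V = 8" and ex: "(\<Sum>v\<in>V. excess v) \<le> 2"
    and K: "K \<in> Fs" and cM: "card (V - K) = 3"
    and exK: "\<exists>v\<in>K. card (N v \<inter> K) \<noteq> d - 1"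
  shows "\<exists>G\<in>Fs. card G = d"
proof (rule ccontr)
  assume nosimplex: "\<not> ?thesis"
  define M where "M = V - K"
  have V2: "2 \<le> card V" using cV by simp
  have KV: "K \<subseteq> V" and fK: "finite K" using facet_subset[OF K] finite_facet[OF K] by auto
  have fM: "finite M" and MV: "M \<subseteq> V" using finite_V M_def by auto
  have cK: "card K = 5"
    using cM cV card_Diff_subset[OF fK KV] card_mono[OF finite_V KV] by simp
  have splitN: "card (N v) = card (N v \<inter> K) + card (N v \<inter> M)" for v
  proof -
    have "N v - K = N v \<inter> M" using nbr_subset[of v] M_def by auto
    thus ?thesis using card_nbr_split[of v K] by simp
  qed
  define eK where "eK v = int (card (N v \<inter> K)) - 3" for v
  define na where "na v = 2 - int (card (N v \<inter> M))" for v
  have id: "(\<Sum>v\<in>V. excess v) = (\<Sum>v\<in>K. eK v) + 1 + 2 * (\<Sum>v\<in>M. excess v) + (\<Sum>v\<in>M. na v)"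
    using excess_identity[OF KV _ cM] cV d unfolding eK_def na_def M_def by simp
  have eK0: "0 \<le> eK v" if "v \<in> K" for v using facet_degree[OF K that] d by (simp add: eK_def)
  have na0: "0 \<le> na v" if "v \<in> M" for v
  proof -
    have "N v \<inter> M \<subseteq> M - {v}" using nbr_subset[of v] by auto
    hence "card (N v \<inter> M) \<le> card (M - {v})" using fM by (intro card_mono) auto
    thus ?thesis using fM that cM M_def by (simp add: na_def)
  qed
  have ex0: "0 \<le> excess v" if "v \<in> V" for v using excess_nonneg that V2 by blast
  obtain z where z: "z \<in> K" "card (N z \<inter> K) \<noteq> 3" using exK d by auto
  have ez: "1 \<le> eK z" using eK0[OF z(1)] z(2) by (simp add: eK_def)
  have sK: "(\<Sum>v\<in>K. eK v) = eK z + (\<Sum>v\<in>K - {z}. eK v)"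
    using sum.remove[OF fK z(1)] by blast
  have p1: "0 \<le> (\<Sum>v\<in>K - {z}. eK v)" using eK0 by (intro sum_nonneg) auto
  have p2: "0 \<le> (\<Sum>v\<in>M. excess v)" using ex0 MV by (intro sum_nonneg) auto
  have p3: "0 \<le> (\<Sum>v\<in>M. na v)" using na0 by (intro sum_nonneg) auto
  have eqs: "eK z = 1" "(\<Sum>v\<in>K - {z}. eK v) = 0" "(\<Sum>v\<in>M. excess v) = 0" "(\<Sum>v\<in>M. na v) = 0"
    using id ex sK ez p1 p2 p3 by linarith+
  have Kz: "card (N z \<inter> K) = 4" using eqs(1) by (simp add: eK_def)
  have Kq: "card (N q \<inter> K) = 3" if "q \<in> K - {z}" for q
    using eqs(2) sum_nonneg_eq_0_iff[of "K - {z}" eK] eK0 fK that by (force simp: eK_def)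
  have Ms: "card (N u) = 4" if "u \<in> M" for u
  proof -
    have "0 \<le> excess v" if "v \<in> M" for v using ex0 MV that by blast
    hence "excess u = 0" using eqs(3) sum_nonneg_eq_0_iff[OF fM, of excess] that by blast
    thus ?thesis unfolding excess_def using d by simp
  qed
  have MM: "card (N u \<inter> M) = 2" if "u \<in> M" for u
    using eqs(4) sum_nonneg_eq_0_iff[OF fM, of na] na0 that by (force simp: na_def)
  have MK: "card (N u \<inter> K) = 2" if "u \<in> M" for u
    using splitN[of u] Ms MM that by simp
  have NM: "N u \<inter> M = M - {u}" if "u \<in> M" for u
    using nbr_subset[of u] MM that fM cM M_def by (intro card_seteq) auto
  have Nz: "N z \<inter> K = K - {z}"
    using nbr_subset[of z] Kz fK cK z(1) by (intro card_seteq) auto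
  have KM1: "1 \<le> card (N v \<inter> M)" if "v \<in> K" for v
  proof -
    have "N v \<inter> M \<noteq> {}" using facet_out[OF K that] nbrD M_def by blast
    thus ?thesis using fM by (simp add: Suc_le_eq card_gt_0_iff)
  qed
  have sum6: "(\<Sum>v\<in>K. card (N v \<inter> M)) = 6"
    using double_count[OF KV MV] MK cM M_def by simp
  define Q where "Q = K - {z}"
  have fQ: "finite Q" and cQ: "card Q = 4" using fK cK z(1) by (auto simp: Q_def)
  have sumQ: "card (N z \<inter> M) + (\<Sum>v\<in>Q. card (N v \<inter> M)) = 6"
    using sum6 sum.remove[OF fK z(1), of "\<lambda>v. card (N v \<inter> M)"] Q_def by simp
  have Qz: "z \<in> N q" if "q \<in> Q" for q using Nz that nbr_sym Q_def by blast
  have QQ: "card (N q \<inter> Q) = 2" if q: "q \<in> Q" for q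
  proof -
    have "N q \<inter> K = insert z (N q \<inter> Q)" using Qz[OF q] z(1) Q_def by blast
    thus ?thesis using Kq[of q] q Q_def by simp
  qed
  \<comment> \<open>Six edges lead from the five vertices of \<open>K\<close> to \<open>M\<close>,
    at least one from each vertex, so at most one vertex of \<open>Q\<close> has more than one;
    \<open>q1\<close> is that vertex if it exists.\<close>
  have "\<exists>q\<in>Q. \<forall>x\<in>Q - {q}. card (N x \<inter> M) = 1"
  proof (cases "\<exists>q\<in>Q. card (N q \<inter> M) \<noteq> 1")
    case True
    then obtain q where q: "q \<in> Q" "card (N q \<inter> M) \<noteq> 1" by blast
    have "card (N x \<inter> M) = 1" if x: "x \<in> Q - {q}" for x
    proof (rule ccontr)
      assume x2: "card (N x \<inter> M) \<noteq> 1"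
      have "(\<Sum>v\<in>Q. card (N v \<inter> M)) = card (N q \<inter> M) + (card (N x \<inter> M) + (\<Sum>v\<in>Q - {q} - {x}. card (N v \<inter> M)))"
        using sum.remove[OF fQ q(1), of "\<lambda>v. card (N v \<inter> M)"]
          sum.remove[of "Q - {q}" x "\<lambda>v. card (N v \<inter> M)"] fQ x by simp
      moreover have "(\<Sum>v\<in>Q - {q} - {x}. 1) \<le> (\<Sum>v\<in>Q - {q} - {x}. card (N v \<inter> M))"
        using KM1 Q_def by (intro sum_mono) auto
      moreover have "card (Q - {q} - {x}) = 2" using q x fQ cQ by simp
      moreover have "1 \<le> card (N q \<inter> M)" "1 \<le> card (N x \<inter> M)" "1 \<le> card (N z \<inter> M)"
        using KM1 q x z Q_def by auto
      ultimately show False using sumQ q(2) x2 by simp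
    qed
    thus ?thesis using q by blast
  next
    case False
    moreover have "Q \<noteq> {}" using cQ by auto
    ultimately show ?thesis by blast
  qed
  then obtain q1 where q1: "q1 \<in> Q" "\<And>x. x \<in> Q \<Longrightarrow> x \<noteq> q1 \<Longrightarrow> card (N x \<inter> M) = 1" by blast
  obtain q2 q4 where q24: "N q1 \<inter> Q = {q2, q4}" "q2 \<noteq> q4" using QQ[OF q1(1)] by (meson card_2_iff)
  have q24': "q2 \<in> Q" "q4 \<in> Q" "q2 \<noteq> q1" "q4 \<noteq> q1" using q24 nbrD by blast+
  have "card (Q - {q1, q2, q4}) = 1" using fQ cQ q1(1) q24 q24' by (simp add: card_Diff_subset)
  then obtain q3 where q3: "Q - {q1, q2, q4} = {q3}" by (metis card_1_singletonE)
  have Q: "Q = {q1, q2, q3, q4}" and q3': "q3 \<in> Q" "q3 \<noteq> q1" "q3 \<noteq> q2" "q3 \<noteq> q4"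
    using q3 q1(1) q24' by blast+
  have n31: "q3 \<notin> N q1" using q24 q3' by blast
  hence n13: "q1 \<notin> N q3" using nbr_commute by blast
  have N3: "N q3 \<inter> Q = {q2, q4}"
    using QQ[OF q3'(1)] n13 nbr_subset[of q3] Q q24(2) by (intro card_seteq) auto
  have N2: "N q2 \<inter> Q = {q1, q3}"
  proof (rule card_seteq[symmetric])
    show "{q1, q3} \<subseteq> N q2 \<inter> Q" using q24 N3 nbr_sym q1(1) q3'(1) by blast
  qed (use fQ QQ[OF q24'(1)] q3'(2) in auto)
  have N4: "N q4 \<inter> Q = {q1, q3}"
  proof (rule card_seteq[symmetric])
    show "{q1, q3} \<subseteq> N q4 \<inter> Q" using q24 N3 nbr_sym q1(1) q3'(1) by blast
  qed (use fQ QQ[OF q24'(2)] q3'(2) in auto)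
  have Ksplit: "N q = insert z (N q \<inter> Q) \<union> (N q \<inter> M)" if "q \<in> Q" for q
    using Qz[OF that] nbrD[of _ q] Q_def M_def by blast
  have simple: "card (N q) = d" if "q \<in> Q" "q \<noteq> q1" for q
    using splitN[of q] Kq[of q] q1(2)[OF that] that d Q_def by simp
  have zV: "z \<in> V" "z \<notin> Q" and QV: "Q \<subseteq> V" and QM: "Q \<inter> M = {}" and zM: "z \<notin> M"
    using z KV Q_def M_def by auto
  \<comment> \<open>From \<open>q3\<close>, simplicity spreads this facet over all of
    \<open>Q\<close>. It must miss some vertex \<open>u3\<close> of \<open>M\<close>, since
    otherwise \<open>z\<close> would be an apex.\<close>
  obtain G where G: "G \<in> Fs" "q3 \<in> G" "z \<notin> G"
    using vertex_facet[of q3 z] q3'(1) zV QV by blast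
  have G24: "q2 \<in> G" "q4 \<in> G"
    using simple_misses_one[OF G(1,2) simple Qz[OF q3'(1)] G(3)] q3' N3 q24' zV by blast+
  have "q1 \<in> N q2" using N2 by blast
  hence G1: "q1 \<in> G"
    using simple_misses_one[OF G(1) G24(1) simple Qz[OF q24'(1)] G(3)] q24' q1(1) zV by blast
  have QG: "Q \<subseteq> G" using Q G(2) G24 G1 by blast
  have uG: "u \<in> G" if "q \<in> Q" "q \<noteq> q1" "u \<in> N q \<inter> M" for q u
    using simple_misses_one[OF G(1) _ simple[OF that(1,2)] Qz[OF that(1)] G(3), of u] QG that zM by blast
  have nM: "\<not> M \<subseteq> G"
  proof
    assume "M \<subseteq> G"
    hence "V - G = {z}" using QG G(3) zV Q_def M_def by blast
    thus False using no_pyramid[OF _ _ ex G(1)] cV d by simp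
  qed
  then obtain u3 where u3: "u3 \<in> M" "u3 \<notin> G" by blast
  have u3q: "q \<notin> N u3" if "q \<in> Q" "q \<noteq> q1" for q
    using uG[OF that, of u3] u3 nbr_commute by blast
  have "N u3 \<inter> K \<subseteq> {z, q1}" using u3q Q_def by blast
  moreover have zq1: "z \<noteq> q1" using zV q1(1) by blast
  ultimately have Nu3K: "N u3 \<inter> K = {z, q1}" using MK[OF u3(1)] by (intro card_seteq) auto
  have cMu: "card (M - {u3}) = 2" using u3(1) fM cM M_def by simp
  have "\<exists>u\<in>M - {u3}. u \<in> N q1 \<and> u \<in> G"
  proof -
    \<comment> \<open>If \<open>G\<close> missed two vertices of \<open>M\<close>, the third would
      be the outer neighbour of \<open>q2\<close>, \<open>q3\<close> and \<open>q4\<close>, but it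
      has only two neighbours in \<open>K\<close>.\<close>
    have GM: "M - {u3} \<subseteq> G"
    proof (rule ccontr)
      assume "\<not> ?thesis"
      then obtain u where u: "u \<in> M" "u \<noteq> u3" "u \<notin> G" by blast
      have "card (M - {u3, u}) = 1" using u u3 fM cM M_def by (simp add: card_Diff_subset)
      then obtain t where t: "M - {u3, u} = {t}" by (metis card_1_singletonE)
      have "t \<in> N q" if q: "q \<in> Q" "q \<noteq> q1" for q
      proof -
        have "N q \<inter> M \<noteq> {}" using q1(2)[OF q] by auto
        then obtain y where y: "y \<in> N q" "y \<in> M" by blast
        hence "y \<in> G" using uG[OF q] by blast
        hence "y \<in> M - {u3, u}" using y u(3) u3(2) by blast
        thus ?thesis using t y by simp
      qed
      hence "q2 \<in> N t" "q3 \<in> N t" "q4 \<in> N t" using q24' q3' nbr_sym[of t] by simp_all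
      hence "{q2, q3, q4} \<subseteq> N t \<inter> K" using q24' q3' Q_def by simp
      hence "card {q2, q3, q4} \<le> card (N t \<inter> K)" by (intro card_mono) auto
      moreover have "t \<in> M" using t by blast
      ultimately show False using MK[of t] q24(2) q3' by simp
    qed
    have zu: "z \<notin> N u" if u: "u \<in> M - {u3}" for u
    proof
      assume "z \<in> N u"
      have "card (N u) = d" "u \<in> G" "u3 \<in> N u" using Ms u d GM NM[of u] u3 by auto
      thus False using simple_misses_one[OF G(1), of u u3 z] u3 G(3) zM \<open>z \<in> N u\<close> by blast
    qed
    have "w = u3" if "w \<in> N z \<inter> M" for w using zu[of w] nbr_sym[of w z] that by blast
    moreover have "u3 \<in> N z" using Nu3K nbr_sym[of z u3] by blast
    ultimately have "N z \<inter> M = {u3}" using u3(1) by blast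
    \<comment> \<open>One of the six edges starts at \<open>z\<close>, so five start in
      \<open>Q\<close>, and \<open>q1\<close> has two of them.\<close>
    hence "(\<Sum>v\<in>Q. card (N v \<inter> M)) = 5" using sumQ by simp
    moreover have "(\<Sum>v\<in>Q. card (N v \<inter> M)) = card (N q1 \<inter> M) + (\<Sum>v\<in>Q - {q1}. card (N v \<inter> M))"
      using sum.remove[OF fQ q1(1)] by blast
    moreover have "(\<Sum>v\<in>Q - {q1}. card (N v \<inter> M)) = 3" using q1 fQ cQ by simp
    ultimately have "card (N q1 \<inter> M) = 2" by simp
    hence "\<not> N q1 \<inter> M \<subseteq> {u3}" using card_mono[of "{u3}" "N q1 \<inter> M"] by auto
    thus ?thesis using GM by blast
  qed
  then obtain u1 where u1: "u1 \<in> M" "u1 \<noteq> u3" "u1 \<in> N q1" "u1 \<in> G" by blast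
  have "card (M - {u3, u1}) = 1" using u1 u3 fM cM M_def by (simp add: card_Diff_subset)
  then obtain u2 where u2': "M - {u3, u1} = {u2}" by (metis card_1_singletonE)
  have u2: "u2 \<in> M" "u2 \<noteq> u3" "u2 \<noteq> u1" and M: "M = {u1, u2, u3}" using u2' u1 u3 by blast+
  have zu: "z \<notin> N u1"
  proof
    assume *: "z \<in> N u1"
    have "u3 \<in> N u1" using NM[OF u1(1)] u3(1) u1(2) by blast
    moreover have "card (N u1) = d" using Ms[OF u1(1)] d by simp
    moreover have "z \<noteq> u3" using u3(1) zM by blast
    ultimately show False using simple_misses_one[OF G(1) u1(4) _ _ u3(2) *] G(3) by blast
  qed
  have Nu3: "N u3 = {u1, u2, z, q1}"
  proof -
    have "N u3 = (N u3 \<inter> K) \<union> (N u3 \<inter> M)" using nbrD[of _ u3] M_def by blast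
    thus ?thesis using Nu3K NM[OF u3(1)] M u1 u2 by auto
  qed
  have "K = insert z Q" using z(1) Q_def by blast
  hence Kset: "K = {z, q1, q2, q3, q4}" using Q by simp
  have "V = K \<union> M" using KV M_def by blast
  hence Vset: "V = {z, q1, q2, q3, q4, u1, u2, u3}" using Kset M by (simp add: insert_commute)
  have dist: "distinct [z, q1, q2, q3, q4, u1, u2, u3]"
    using q24(2) q24' q3' u1(1,2) u2 u3(1) zV(2) QM zM q1(1) by auto
  have "q1 \<in> N u1 \<inter> K" using u1(3) nbr_sym q1(1) Q_def by blast
  hence "card (N u1 \<inter> K - {q1}) = 1" using MK[OF u1(1)] by simp
  then obtain x where x': "N u1 \<inter> K - {q1} = {x}" by (metis card_1_singletonE)
  have x: "N u1 \<inter> K = {q1, x}" "x \<noteq> q1" using x' \<open>q1 \<in> N u1 \<inter> K\<close> by blast+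
  have Nu1: "N u1 = {u2, u3, q1, x}"
  proof -
    have "N u1 = (N u1 \<inter> K) \<union> (N u1 \<inter> M)" using nbrD[of _ u1] M_def by blast
    thus ?thesis using x NM[OF u1(1)] M u1 u2 by auto
  qed
  have "x \<in> N u1" "x \<in> K" using x(1) by auto
  hence xQ: "x \<in> Q" using zu Q_def by blast
  have x24: "x \<in> {q2, q3, q4}" using xQ x(2) Q by simp
  have Nqu: "N q \<inter> M = {if q = x then u1 else u2}" if q: "q \<in> Q" "q \<noteq> q1" for q
  proof -
    obtain t where t: "N q \<inter> M = {t}" using q1(2)[OF q] by (metis card_1_singletonE)
    have "u1 \<in> N q \<longleftrightarrow> q = x" using x q nbr_commute[of u1 q] Q_def by blast
    moreover have "u3 \<notin> N q" using u3q[OF q] nbr_commute by blast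
    moreover have "t \<in> N q" "t = u1 \<or> t = u2 \<or> t = u3" using t M by auto
    moreover have "u1 \<in> N q \<longrightarrow> u1 \<in> {t}" using t[symmetric] u1(1) by simp
    ultimately have "t = (if q = x then u1 else u2)" by auto
    thus ?thesis using t by simp
  qed
  have Nfull: "N q = insert z (N q \<inter> Q) \<union> {if q = x then u1 else u2}" if "q \<in> Q" "q \<noteq> q1" for q
    using Ksplit[OF that(1)] unfolding Nqu[OF that] .
  have N2': "N q2 = {z, q1, q3, if q2 = x then u1 else u2}"
    and N3': "N q3 = {z, q2, q4, if q3 = x then u1 else u2}"
    and N4': "N q4 = {z, q1, q3, if q4 = x then u1 else u2}"
    using Nfull[OF q24'(1,3), unfolded N2] Nfull[OF q3'(1,2), unfolded N3]
      Nfull[OF q24'(2,4), unfolded N4] by (simp_all add: insert_commute)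
  \<comment> \<open>\<open>x\<close> is the second neighbour of \<open>u1\<close> in
    \<open>K\<close>. The cases \<open>q2\<close> and \<open>q4\<close> are mirror images of each
    other; \<open>q3\<close>, opposite to \<open>q1\<close>, is the other configuration.\<close>
  consider "x = q2" | "x = q3" | "x = q4" using x24 by blast
  thus False
  proof cases
    case 1
    have "N q3 = {z, q2, q4, u2}" "N q4 = {z, q1, q3, u2}" "N u1 = {u2, u3, q1, q2}"
      using N3' N4' Nu1 1 q3'(3) q24(2) by simp_all
    thus False using wheel_facet_imp_simplex_facet[OF d Vset dist _ _ _ Nu3] nosimplex by blast
  next
    case 3
    have "V = {z, q1, q4, q3, q2, u1, u2, u3}" "distinct [z, q1, q4, q3, q2, u1, u2, u3]"
      using Vset dist by (auto simp: insert_commute)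
    moreover have "N q3 = {z, q4, q2, u2}" "N q2 = {z, q1, q3, u2}" "N u1 = {u2, u3, q1, q4}"
      using N3' N2' Nu1 3 q3'(4) q24(2) by (simp_all add: insert_commute)
    ultimately show False
      using wheel_facet_imp_simplex_facet[OF d _ _ _ _ _ Nu3] nosimplex by blast
  next
    case 2
    have "N u2 \<inter> K = {q2, q4}"
    proof (rule card_seteq[symmetric])
      show "{q2, q4} \<subseteq> N u2 \<inter> K"
        using N2' N4' 2 q3' nbr_sym[of u2 q2] nbr_sym[of u2 q4] q24' Q_def by simp
    qed (use MK[OF u2(1)] q24(2) in auto)
    moreover have "N u2 = (N u2 \<inter> K) \<union> (N u2 \<inter> M)" using nbrD[of _ u2] M_def by blast
    ultimately have Nu2: "N u2 = {u1, u3, q2, q4}" using NM[OF u2(1)] M u1 u2 by auto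
    have Nq1: "N q1 \<inter> K = {z, q2, q4}" using q24(1) Qz[OF q1(1)] z(1) Q_def by blast
    show False
      by (rule wheel_facet_impossible[OF d Vset dist K Kset Nq1 _ _ Nu2])
         (use N2' N4' Nu1 2 q3' in auto)
  qed
qed

section \<open>Existence of a simplex facet\<close>

text \<open>A facet with \<open>m \<noteq> 2\<close> that is no simplex has
  \<open>3 \<le> m < d\<close>, so both factors of the product are positive, and the excess inside
  the facet costs one more unit. The condition \<open>nonsimple\<close> enters as a hypothesis
  because the locale does not record the facets of a facet.\<close>

lemma simplex_facet_exists:
  assumes d: "4 \<le> d" and cV: "card V = 2 * d" and ex: "(\<Sum>v\<in>V. excess v) \<le> 2"
    and nonsimple: "\<And>K. K \<in> Fs \<Longrightarrow> d < card K \<Longrightarrow> card K < 2 * (d - 1) \<Longrightarrow> \<exists>v\<in>K. card (N v \<inter> K) \<noteq> d - 1"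
  shows "\<exists>K\<in>Fs. card K = d"
proof (rule ccontr)
  assume no: "\<not> ?thesis"
  obtain K where K: "K \<in> Fs" "card (V - K) \<noteq> 2" using facet_missing_not_two[OF d cV ex] by blast
  define m where "m = card (V - K)"
  have KV: "K \<subseteq> V" and fK: "finite K" using facet_subset[OF K(1)] finite_facet[OF K(1)] by auto
  have V2: "2 \<le> card V" using d cV by simp
  have cK: "card K + m = 2 * d"
    unfolding m_def using card_Diff_subset[OF fK KV] card_mono[OF finite_V KV] cV by simp
  have gt: "d < card K" using card_facet_ge[OF K(1)] no K(1) by (metis le_neq_implies_less)
  have "m \<noteq> 0" using facet_proper[OF K(1)] finite_V unfolding m_def by auto
  moreover have "m \<noteq> 1" using no_pyramid[OF cV d ex K(1)] unfolding m_def by (metis card_1_singletonE)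
  ultimately have m3: "3 \<le> m" using K(2) m_def by linarith
  have nsK: "\<exists>v\<in>K. card (N v \<inter> K) \<noteq> d - 1"
    by (rule nonsimple[OF K(1) gt]) (use cK m3 d in linarith)
  then obtain v where v: "v \<in> K" "card (N v \<inter> K) \<noteq> d - 1" by blast
  define e where "e v = int (card (N v \<inter> K)) - (int d - 1)" for v
  have e0: "0 \<le> e v" if "v \<in> K" for v using facet_degree[OF K(1) that] by (simp add: e_def)
  have "1 \<le> e v" using e0[OF v(1)] v(2) d by (auto simp: e_def)
  moreover have "sum e {v} \<le> sum e K" using v(1) fK e0 by (intro sum_mono2) auto
  ultimately have s1: "1 \<le> sum e K" by simp
  have s2: "0 \<le> (\<Sum>v\<in>V - K. excess v)" using excess_nonneg V2 by (intro sum_nonneg) auto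
  have s3: "0 \<le> (\<Sum>v\<in>V - K. int m - 1 - int (card (N v \<inter> (V - K))))"
  proof (rule sum_nonneg)
    fix v assume v: "v \<in> V - K"
    have "N v \<inter> (V - K) \<subseteq> V - K - {v}" using nbr_subset[of v] by auto
    hence "card (N v \<inter> (V - K)) \<le> card (V - K - {v})" using finite_V by (intro card_mono) auto
    also have "\<dots> = m - 1" unfolding m_def using v finite_V by simp
    finally show "0 \<le> int m - 1 - int (card (N v \<inter> (V - K)))" using m3 by simp
  qed
  have "(int m - 2) * (int d - int m) \<le> 1"
    using excess_identity[OF KV cV, of m] ex s1 s2 s3 unfolding m_def e_def by simp
  moreover have i1: "1 \<le> int m - 2" and i2: "1 \<le> int d - int m" using m3 gt cK by linarith+
  moreover have "int m - 2 \<le> (int m - 2) * (int d - int m)"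
    using mult_left_mono[of 1 "int d - int m" "int m - 2"] i1 i2 by simp
  moreover have "int d - int m \<le> (int m - 2) * (int d - int m)"
    using mult_right_mono[of 1 "int m - 2" "int d - int m"] i1 i2 by simp
  ultimately have "m = 3" "d = 4" by linarith+
  thus False using pyramid_facet_imp_simplex_facet[OF _ _ ex K(1) _ nsK] cV no m_def by simp
qed

end

section \<open>The graph of a polytope\<close>

lemma finite_vertices:
  assumes "polytope P"
  shows "finite (vertices_of P)"
  using assms finite_polyhedron_extreme_points polytope_imp_polyhedron
  unfolding vertices_of_def by blast

lemma vertices_subset: "vertices_of P \<subseteq> P"
  unfolding vertices_of_def extreme_point_of_def by blast

lemma polytope_hull_vertices:
  assumes "polytope P"
  shows "convex hull (vertices_of P) = P"
  using assms Krein_Milman_polytope unfolding vertices_of_def polytope_def by metis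

lemma vertices_of_face:
  assumes "F face_of P"
  shows "vertices_of F = vertices_of P \<inter> F"
  using extreme_point_of_face[OF assms] unfolding vertices_of_def by blast

lemma face_hull_vertices:
  assumes "polytope P" "F face_of P"
  shows "convex hull (vertices_of P \<inter> F) = F"
  using polytope_hull_vertices[of F] vertices_of_face[OF assms(2)]
    face_of_polytope_polytope[OF assms] by simp

lemma vertices_of_segment: "vertices_of (closed_segment u w) = {u, w}"
  unfolding vertices_of_def by (auto simp: extreme_point_of_segment)

lemma polytope_aff_dim_1:
  assumes "polytope F" "aff_dim F = 1"
  obtains u w where "u \<noteq> w" "F = closed_segment u w"
proof -
  have "F \<noteq> {}" using assms by auto
  moreover have "collinear F" using assms(2) collinear_aff_dim[of F] by simp
  ultimately obtain u w where "F = closed_segment u w"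
    using compact_convex_collinear_segment[of F] polytope_imp_compact[OF assms(1)]
      polytope_imp_convex[OF assms(1)] by metis
  moreover have "u \<noteq> w" using calculation assms(2) by auto
  ultimately show ?thesis using that by blast
qed

lemma face_with_rel_interior_point:
  fixes P :: "'a::euclidean_space set"
  assumes "polytope P" "y \<in> P"
  shows "\<exists>F. F face_of P \<and> y \<in> rel_interior F"
  using assms
proof (induction "nat (aff_dim P + 1)" arbitrary: P rule: less_induct)
  case less
  show ?case
  proof (cases "y \<in> rel_interior P")
    case True
    thus ?thesis using less.prems face_of_refl polytope_imp_convex by blast
  next
    case False
    then obtain G where G: "G facet_of P" "y \<in> G"
      using rel_interior_of_polyhedron[OF polytope_imp_polyhedron[OF less.prems(1)]] less.prems(2) by blast
    have GP: "G face_of P" using G facet_of_imp_face_of by blast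
    have "aff_dim G = aff_dim P - 1" using G by (simp add: facet_of_def)
    moreover have "aff_dim G \<ge> 0" using G(2) aff_dim_negative_iff[of G] by (metis empty_iff not_less)
    ultimately have "nat (aff_dim G + 1) < nat (aff_dim P + 1)" by linarith
    then obtain F where "F face_of G" "y \<in> rel_interior F"
      using less.hyps[OF _ face_of_polytope_polytope[OF less.prems(1) GP] G(2)] by blast
    thus ?thesis using GP face_of_trans by blast
  qed
qed

text \<open>Let \<open>F\<close> be the face with \<open>y\<close> in its relative interior. If its
  dimension were at least 2, its affine hull would meet the hyperplane in more than
  \<open>y\<close>, and \<open>y\<close> would be the midpoint of a short segment inside the
  section.\<close>

lemma extreme_point_of_section:
  fixes P :: "'a::euclidean_space set"
  assumes "polytope P" and y: "y extreme_point_of (P \<inter> {x. a \<bullet> x = b})"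
  shows "\<exists>F. F face_of P \<and> y \<in> F \<and> aff_dim F \<le> 1"
proof -
  have yP: "y \<in> P" "a \<bullet> y = b" using y unfolding extreme_point_of_def by auto
  obtain F where F: "F face_of P" "y \<in> rel_interior F"
    using face_with_rel_interior_point[OF assms(1) yP(1)] by blast
  have yF: "y \<in> F" using F(2) rel_interior_subset by blast
  have "aff_dim F \<le> 1"
  proof (rule ccontr)
    assume "\<not> ?thesis"
    hence dimF: "aff_dim F \<ge> 2" by simp
    define L where "L = affine hull F"
    have L: "affine L" "aff_dim L = aff_dim F" "y \<in> L"
      unfolding L_def using yF by (auto simp: hull_inc)
    have "L \<inter> {x. a \<bullet> x = b} \<noteq> {y}"
    proof
      assume eq: "L \<inter> {x. a \<bullet> x = b} = {y}"
      hence "aff_dim (L \<inter> {x. a \<bullet> x = b}) = 0" by simp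
      thus False using aff_dim_affine_Int_hyperplane[OF L(1), of a b] dimF L(2) eq
        by (auto split: if_splits)
    qed
    then obtain w where w: "w \<in> L" "a \<bullet> w = b" "w \<noteq> y" using L(3) yP(2) by blast
    obtain e where e: "e > 0" "cball y e \<inter> L \<subseteq> F"
      using F(2) unfolding mem_rel_interior_cball L_def by blast
    \<comment> \<open>Scaled so that \<open>p\<close> and \<open>q\<close> lie at distance
      \<open>e\<close> from \<open>y\<close>, inside the ball whose part in \<open>L\<close> belongs
      to \<open>F\<close>.\<close>
    define t where "t = e / norm (w - y)"
    have t: "t > 0" using e w by (simp add: t_def)
    define p q where "p = y + t *\<^sub>R (w - y)" and "q = y - t *\<^sub>R (w - y)"
    have pq: "p = (1 - t) *\<^sub>R y + t *\<^sub>R w" "q = (1 + t) *\<^sub>R y + (- t) *\<^sub>R w"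
      unfolding p_def q_def by (auto simp: algebra_simps)
    have "p \<in> L" "q \<in> L" unfolding pq using L w by (auto intro!: mem_affine simp del: scaleR_minus_left)
    moreover have "dist y p = e" "dist y q = e"
      unfolding p_def q_def dist_norm using e w by (auto simp: t_def)
    ultimately have "p \<in> F" "q \<in> F" using e by auto
    hence "p \<in> P" "q \<in> P" using F(1) face_of_imp_subset by blast+
    moreover have "a \<bullet> p = b" "a \<bullet> q = b"
      unfolding p_def q_def using w yP by (auto simp: inner_add_right inner_diff_right)
    moreover have "y = midpoint p q"
      unfolding p_def q_def midpoint_def by (simp add: scaleR_2[symmetric])
    moreover have "p \<noteq> q"
    proof
      assume "p = q"
      hence "(t + t) *\<^sub>R (w - y) = 0" unfolding p_def q_def scaleR_add_left by (simp add: algebra_simps)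
      thus False using t w by simp
    qed
    ultimately show False
      using y midpoint_in_open_segment[of p q] unfolding extreme_point_of_def by blast
  qed
  thus ?thesis using F yF by blast
qed

section \<open>Edges at a vertex\<close>

definition nbrs :: "'a::euclidean_space set \<Rightarrow> 'a \<Rightarrow> 'a set" where
  "nbrs P v = {w. w \<noteq> v \<and> closed_segment v w face_of P}"

lemma nbrs_sym: "w \<in> nbrs P v \<Longrightarrow> v \<in> nbrs P w"
  unfolding nbrs_def by (auto simp: closed_segment_commute)

lemma nbrs_vertices:
  assumes "w \<in> nbrs P v"
  shows "v \<in> vertices_of P" "w \<in> vertices_of P"
  using vertices_of_face[of "closed_segment v w" P] assms vertices_of_segment[of v w]
  unfolding nbrs_def by auto

lemma nbrs_face:
  assumes "F face_of P" "v \<in> F"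
  shows "nbrs F v = nbrs P v \<inter> F"
proof -
  have "closed_segment v w \<subseteq> F \<longleftrightarrow> w \<in> F" for w
    using assms(2) face_of_imp_convex[OF assms(1)] closed_segment_subset[of v F w] by auto
  thus ?thesis unfolding nbrs_def face_of_face[OF assms(1)] by blast
qed

text \<open>
  A hyperplane that separates \<open>v\<close> from the other vertices cuts out a polytope whose extreme
  points lie on the edges at \<open>v\<close>.
\<close>

lemma affine_hull_nbrs:
  fixes P :: "'a::euclidean_space set"
  assumes P: "polytope P" and v: "v \<in> vertices_of P"
  shows "P \<subseteq> affine hull (insert v (nbrs P v))"
proof -
  define V where "V = vertices_of P"
  define L where "L = affine hull (insert v (nbrs P v))"
  have affL: "affine L" and vL: "v \<in> L" unfolding L_def by (auto intro: hull_inc)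
  have fV: "finite V" and hV: "convex hull V = P"
    unfolding V_def using finite_vertices polytope_hull_vertices P by auto
  have "v \<notin> convex hull (V - {v})"
  proof
    assume *: "v \<in> convex hull (V - {v})"
    have "convex hull (V - {v}) \<subseteq> P" using hV hull_mono[of "V - {v}" V convex] by blast
    moreover have "v extreme_point_of P" using v by (simp add: vertices_of_def)
    ultimately have "v extreme_point_of (convex hull (V - {v}))"
      using * unfolding extreme_point_of_def by blast
    thus False using extreme_point_of_convex_hull by blast
  qed
  moreover have "closed (convex hull (V - {v}))"
    using fV by (simp add: finite_imp_compact_convex_hull compact_imp_closed)
  ultimately obtain a b where ab: "a \<bullet> v < b" "\<And>x. x \<in> convex hull (V - {v}) \<Longrightarrow> b < a \<bullet> x"
    using separating_hyperplane_closed_point[of "convex hull (V - {v})" v] by auto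
  have abV: "b < a \<bullet> x" if "x \<in> V" "x \<noteq> v" for x using ab(2) that by (simp add: hull_inc)
  define S where "S = P \<inter> {x. a \<bullet> x = b}"
  have "polytope S" unfolding S_def by (intro polytope_Int_polyhedron P polyhedron_hyperplane)
  hence hS: "convex hull (vertices_of S) = S" by (rule polytope_hull_vertices)
  have "vertices_of S \<subseteq> L"
  proof
    fix y assume "y \<in> vertices_of S"
    hence y: "y extreme_point_of S" by (simp add: vertices_of_def)
    then obtain F where F: "F face_of P" "y \<in> F" "aff_dim F \<le> 1"
      using extreme_point_of_section[OF P] unfolding S_def by blast
    have ay: "a \<bullet> y = b" using y unfolding S_def extreme_point_of_def by blast
    have "aff_dim F \<noteq> 0"
    proof
      assume "aff_dim F = 0"
      hence "F = {y}" using F(2) aff_dim_eq_0[of F] by auto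
      hence "y \<in> V" using F(1) face_of_singleton unfolding V_def vertices_of_def by blast
      thus False using abV[of y] ay ab(1) by force
    qed
    moreover have "aff_dim F \<ge> 0" using F(2) aff_dim_negative_iff[of F] by (metis empty_iff not_less)
    ultimately have "aff_dim F = 1" using F(3) by linarith
    then obtain p q where pq: "p \<noteq> q" "F = closed_segment p q"
      using polytope_aff_dim_1 face_of_polytope_polytope[OF P F(1)] by blast
    have pqn: "q \<in> nbrs P p" "p \<in> nbrs P q"
      using pq F(1) unfolding nbrs_def by (auto simp: closed_segment_commute)
    have "p = v \<or> q = v"
    proof (rule ccontr)
      assume "\<not> ?thesis"
      hence "p \<in> {x. b < a \<bullet> x}" "q \<in> {x. b < a \<bullet> x}"
        using abV nbrs_vertices[OF pqn(1)] V_def by auto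
      hence "closed_segment p q \<subseteq> {x. b < a \<bullet> x}"
        by (intro closed_segment_subset) (auto simp: convex_halfspace_gt)
      thus False using F(2) pq(2) ay by auto
    qed
    hence "{p, q} \<subseteq> insert v (nbrs P v)" using pqn by blast
    hence "{p, q} \<subseteq> L" unfolding L_def by (meson hull_subset subset_trans)
    hence "closed_segment p q \<subseteq> L" using affL
      by (intro closed_segment_subset affine_imp_convex) auto
    thus "y \<in> L" using F(2) pq(2) by blast
  qed
  hence SL: "S \<subseteq> L" using hS hull_minimal[of "vertices_of S" L convex] affine_imp_convex[OF affL] by simp
  have "x \<in> L" if x: "x \<in> V" for x
  proof (cases "x = v")
    case False
    hence ax: "b < a \<bullet> x" using abV x by blast
    \<comment> \<open>The segment from \<open>v\<close> to \<open>x\<close> crosses the hyperplane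
      at \<open>y\<close>, which lies in \<open>S\<close> and hence in \<open>L\<close>;
      \<open>x\<close> is then recovered on the line through \<open>v\<close> and
      \<open>y\<close>.\<close>
    define t where "t = (b - a \<bullet> v) / (a \<bullet> x - a \<bullet> v)"
    have t: "0 < t" "t < 1" using ax ab(1) by (auto simp: t_def)
    define y where "y = v + t *\<^sub>R (x - v)"
    have y': "y = (1 - t) *\<^sub>R v + t *\<^sub>R x" unfolding y_def by (simp add: algebra_simps)
    have "v \<in> P" "x \<in> P" using v x vertices_subset V_def by blast+
    hence "y \<in> P" unfolding y' using polytope_imp_convex[OF P] t by (intro convexD) auto
    moreover have "a \<bullet> y = b"
    proof -
      have "a \<bullet> y = a \<bullet> v + t * (a \<bullet> x - a \<bullet> v)"
        by (simp add: y_def inner_add_right inner_diff_right)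
      thus ?thesis using ax ab(1) by (simp add: t_def)
    qed
    ultimately have "y \<in> L" using SL S_def by blast
    hence "(1 - 1 / t) *\<^sub>R v + (1 / t) *\<^sub>R y \<in> L" using affL vL by (intro mem_affine) auto
    moreover have "(1 - 1 / t) *\<^sub>R v + (1 / t) *\<^sub>R y = x"
      using t by (simp add: y_def algebra_simps)
    ultimately show ?thesis by simp
  qed (use vL in simp)
  thus ?thesis using hV hull_minimal[of V L convex] affine_imp_convex[OF affL] L_def by blast
qed

text \<open>Otherwise \<open>affine_hull_nbrs\<close> would put \<open>P\<close> into the affine
  hull of \<open>F\<close>, which has smaller dimension.\<close>

lemma proper_face_misses_nbr:
  fixes P :: "'a::euclidean_space set"
  assumes P: "polytope P" and F: "F face_of P" "F \<noteq> P" and v: "v \<in> vertices_of P" "v \<in> F"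
  shows "\<exists>w\<in>nbrs P v. w \<notin> F"
proof (rule ccontr)
  assume "\<not> ?thesis"
  hence "insert v (nbrs P v) \<subseteq> F" using v by blast
  hence "P \<subseteq> affine hull F" using affine_hull_nbrs[OF P v(1)] hull_mono by blast
  hence "aff_dim P \<le> aff_dim F" using aff_dim_subset aff_dim_affine_hull by metis
  thus False using face_of_aff_dim_lt[OF polytope_imp_convex[OF P] F] by simp
qed

lemma facet_avoiding:
  assumes P: "polytope P" and R: "R face_of P" "R \<noteq> {}" and w: "w \<in> P" "w \<notin> R"
  shows "\<exists>K. K facet_of P \<and> R \<subseteq> K \<and> w \<notin> K"
proof -
  have "R \<noteq> P" using w by blast
  hence "R = \<Inter>{F. F facet_of P \<and> R \<subseteq> F}"
    by (rule face_of_polyhedron[OF polytope_imp_polyhedron[OF P] R])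
  hence "w \<notin> \<Inter>{F. F facet_of P \<and> R \<subseteq> F}" using w(2) by simp
  thus ?thesis by blast
qed

definition facet_sets :: "'a::euclidean_space set \<Rightarrow> 'a set set" where
  "facet_sets P = (\<lambda>K. vertices_of P \<inter> K) ` {K. K facet_of P}"

lemma face_affine_hull:
  fixes P :: "'a::euclidean_space set"
  assumes P: "polytope P" and K: "K face_of P" and v: "v \<in> vertices_of P" "v \<in> K"
  shows "affine hull K = affine hull (insert v (nbrs P v \<inter> K))"
proof
  have vK: "v \<in> vertices_of K" using vertices_of_face[OF K] v by blast
  have "K \<subseteq> affine hull (insert v (nbrs P v \<inter> K))"
    using affine_hull_nbrs[OF face_of_polytope_polytope[OF P K] vK] nbrs_face[OF K v(2)] by simp
  thus "affine hull K \<subseteq> affine hull (insert v (nbrs P v \<inter> K))"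
    by (simp add: hull_minimal)
  show "affine hull (insert v (nbrs P v \<inter> K)) \<subseteq> affine hull K"
    using v(2) by (intro hull_mono) auto
qed

text \<open>The conditions on degrees and missed neighbours rest on the fact that a vertex and its
  neighbours in a face span the face affinely. The separating facets come from
  \<open>facet_avoiding\<close>, and \<open>apex\<close> from the faces of a pyramid.\<close>

lemma polytope_graph_of_polytope:
  fixes P :: "'a::euclidean_space set"
  assumes P: "polytope P" and dim: "aff_dim P = int d"
  shows "polytope_graph (vertices_of P) (nbrs P) (facet_sets P) d"
proof -
  define V where "V = vertices_of P"
  have fV: "finite V" using finite_vertices[OF P] V_def by simp
  have cvx: "convex P" using polytope_imp_convex[OF P] .
  have nV: "nbrs P v \<subseteq> V" for v using nbrs_vertices V_def by blast
  have fN: "finite (nbrs P v)" for v using nV fV finite_subset by blast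
  have VP: "V \<subseteq> P" using vertices_subset V_def by blast
  have card_le: "d \<le> Suc (card (nbrs P v \<inter> K))" if K: "K facet_of P" "v \<in> V" "v \<in> K" for K v
  proof -
    have "int d - 1 = aff_dim K" using K dim by (simp add: facet_of_def)
    also have "\<dots> = aff_dim (insert v (nbrs P v \<inter> K))"
      using face_affine_hull[OF P facet_of_imp_face_of[OF K(1)]] K aff_dim_affine_hull V_def by metis
    also have "\<dots> \<le> int (card (insert v (nbrs P v \<inter> K))) - 1"
      using fN by (intro aff_dim_le_card) simp
    also have "\<dots> \<le> int (card (nbrs P v \<inter> K))" using fN by (simp add: card_insert_if)
    finally show ?thesis by linarith
  qed
  have KV: "nbrs P v \<inter> (V \<inter> K) = nbrs P v \<inter> K" for v K using nV by blast
  have ex_facet: "\<exists>F. F facet_of P \<and> K = V \<inter> F" if "K \<in> facet_sets P" for K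
    using that unfolding facet_sets_def V_def by blast
  have "polytope_graph V (nbrs P) (facet_sets P) d"
  proof
    show "finite V" by (rule fV)
    show "v \<in> V \<and> w \<in> V \<and> w \<noteq> v" if "w \<in> nbrs P v" for v w
      using that nbrs_vertices[OF that] by (auto simp: V_def nbrs_def)
    show "v \<in> nbrs P w" if "w \<in> nbrs P v" for v w using that by (rule nbrs_sym)
    show "K \<subseteq> V" if "K \<in> facet_sets P" for K using that by (auto simp: facet_sets_def V_def)
    show "K \<noteq> {}" if K: "K \<in> facet_sets P" for K
    proof -
      obtain F where F: "F facet_of P" "K = V \<inter> F" using ex_facet K by blast
      have "F \<noteq> {}" using F by (simp add: facet_of_def)
      thus ?thesis using face_hull_vertices[OF P facet_of_imp_face_of[OF F(1)]] F(2) V_def by auto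
    qed
    show "d \<le> Suc (card (nbrs P v \<inter> K))" if K: "K \<in> facet_sets P" "v \<in> K" for K v
    proof -
      obtain F where F: "F facet_of P" "K = V \<inter> F" using ex_facet K(1) by blast
      show ?thesis using card_le[OF F(1), of v] K(2) F(2) KV by simp
    qed
    show "\<exists>w\<in>nbrs P v. w \<notin> K" if K: "K \<in> facet_sets P" "v \<in> K" for K v
    proof -
      obtain F where F: "F facet_of P" "K = V \<inter> F" using ex_facet K by blast
      have "F \<noteq> P" using F(1) facet_of_irrefl by blast
      then obtain w where "w \<in> nbrs P v" "w \<notin> F"
        using proper_face_misses_nbr[OF P facet_of_imp_face_of[OF F(1)]] K F V_def by blast
      thus ?thesis using F by blast
    qed
    show "\<exists>w\<in>nbrs P v \<inter> K. w \<notin> G"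
      if K: "K \<in> facet_sets P" "G \<in> facet_sets P" "K \<noteq> G" "v \<in> K" "v \<in> G" for K G v
    proof -
      obtain F where F: "F facet_of P" "K = V \<inter> F" using ex_facet K by blast
      obtain H where H: "H facet_of P" "G = V \<inter> H" using ex_facet K by blast
      have faces: "F face_of P" "H face_of P" using F H facet_of_imp_face_of by auto
      have FH: "F \<inter> H face_of F" using face_of_face[OF faces(1)] face_of_Int[OF faces] by simp
      have "F \<inter> H \<noteq> F"
      proof
        assume "F \<inter> H = F"
        hence "F face_of H" using face_of_face[OF faces(2)] faces(1) by blast
        moreover have "aff_dim F = aff_dim H" using F H by (simp add: facet_of_def)
        ultimately have "F = H"
          using face_of_aff_dim_lt[OF face_of_imp_convex[OF faces(2)]] by fastforce
        thus False using K(3) F H by simp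
      qed
      moreover have "v \<in> vertices_of F" using vertices_of_face[OF faces(1)] K F V_def by blast
      moreover have "v \<in> F \<inter> H" using K F H by blast
      ultimately obtain w where "w \<in> nbrs F v" "w \<notin> F \<inter> H"
        using proper_face_misses_nbr[OF face_of_polytope_polytope[OF P faces(1)] FH] by blast
      moreover have "v \<in> F" using K F by blast
      ultimately have "w \<in> nbrs P v \<inter> F" "w \<notin> H" using nbrs_face[OF faces(1)] by auto
      thus ?thesis using F H nV by blast
    qed
    show "K = G" if K: "K \<in> facet_sets P" "G \<in> facet_sets P" "v \<in> K" "v \<in> G"
      "card (nbrs P v) = d" "w \<in> nbrs P v" "w \<notin> K" "w \<notin> G" for K G v w
    proof -
      obtain F where F: "F facet_of P" "K = V \<inter> F" using ex_facet K by blast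
      obtain H where H: "H facet_of P" "G = V \<inter> H" using ex_facet K by blast
      have faces: "F face_of P" "H face_of P" using F H facet_of_imp_face_of by auto
      \<comment> \<open>A facet through the simple vertex \<open>v\<close> keeps at least
        \<open>d - 1\<close> of its neighbours, hence all but \<open>w\<close>. These determine the
        affine hull of the facet, and this determines the facet.\<close>
      have all_but: "nbrs P v \<inter> E = nbrs P v - {w}"
        if E: "E facet_of P" "v \<in> V \<inter> E" "w \<notin> V \<inter> E" for E
      proof (rule card_seteq)
        show "finite (nbrs P v - {w})" using fN by simp
        show "nbrs P v \<inter> E \<subseteq> nbrs P v - {w}" using E nV by blast
        show "card (nbrs P v - {w}) \<le> card (nbrs P v \<inter> E)"
          using card_le[OF E(1), of v] E(2) K(5,6) fN by simp
      qed
      have "affine hull F = affine hull H"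
        using face_affine_hull[OF P faces(1), of v] face_affine_hull[OF P faces(2), of v]
          all_but[OF F(1)] all_but[OF H(1)] K F H V_def by auto
      hence "F = H"
        using face_of_imp_eq_affine_Int[OF cvx faces(1)] face_of_imp_eq_affine_Int[OF cvx faces(2)] by simp
      thus ?thesis using F H by simp
    qed
    show "\<exists>K\<in>facet_sets P. v \<in> K \<and> w \<notin> K" if vw: "v \<in> V" "w \<in> V" "v \<noteq> w" for v w
    proof -
      have "{v} face_of P" using vw face_of_singleton V_def vertices_of_def by blast
      then obtain K where "K facet_of P" "v \<in> K" "w \<notin> K"
        using facet_avoiding[OF P, of "{v}" w] vw VP by blast
      thus ?thesis using vw unfolding facet_sets_def V_def by blast
    qed
    show "\<exists>K\<in>facet_sets P. u \<in> K \<and> v \<in> K \<and> w \<notin> K"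
      if uv: "v \<in> nbrs P u" "w \<in> V" "w \<noteq> u" "w \<noteq> v" for u v w
    proof -
      have face: "closed_segment u v face_of P" using uv by (simp add: nbrs_def)
      have "w \<notin> closed_segment u v"
        using vertices_of_face[OF face] vertices_of_segment[of u v] uv V_def by blast
      hence "\<exists>K. K facet_of P \<and> closed_segment u v \<subseteq> K \<and> w \<notin> K"
        using uv(2) VP by (intro facet_avoiding[OF P face]) auto
      then obtain K where "K facet_of P" "closed_segment u v \<subseteq> K" "w \<notin> K" by blast
      moreover have "u \<in> V" "v \<in> V" using nbrs_vertices[OF uv(1)] V_def by auto
      moreover have "u \<in> closed_segment u v" "v \<in> closed_segment u v" by auto
      ultimately show ?thesis unfolding facet_sets_def V_def by blast
    qed
    show "nbrs P x = K" if K: "K \<in> facet_sets P" "V - K = {x}" for K x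
    proof
      obtain F where F: "F facet_of P" "K = V \<inter> F" using ex_facet K by blast
      have face: "F face_of P" using F facet_of_imp_face_of by blast
      have x: "x \<in> V" "x \<notin> F" using K F by blast+
      show "nbrs P x \<subseteq> K" using K nV[of x] unfolding nbrs_def by blast
      have xaff: "x \<notin> affine hull F" using face_of_imp_eq_affine_Int[OF cvx face] x VP by blast
      have "convex hull (insert x F) = P"
      proof
        show "convex hull (insert x F) \<subseteq> P"
          using x VP face_of_imp_subset[OF face] cvx by (intro hull_minimal) auto
        have "V \<subseteq> insert x F" using K F by blast
        thus "P \<subseteq> convex hull (insert x F)"
          using polytope_hull_vertices[OF P] hull_mono[of V "insert x F" convex] V_def by simp
      qed
      \<comment> \<open>\<open>P\<close> is the pyramid with apex \<open>x\<close> over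
        \<open>F\<close>; joining \<open>x\<close> to a face of the base, here a vertex, gives a
        face of \<open>P\<close>.\<close>
      moreover have "convex hull (insert x {y}) face_of convex hull (insert x F)" if y: "y \<in> K" for y
      proof (rule face_of_polytope_insert2[OF face_of_polytope_polytope[OF P face] xaff])
        show "{y} face_of F"
          using y F vertices_of_face[OF face] unfolding face_of_singleton V_def vertices_of_def by blast
      qed
      ultimately have "closed_segment x y face_of P" if "y \<in> K" for y
        using that by (simp add: segment_convex_hull)
      thus "K \<subseteq> nbrs P x" using F x unfolding nbrs_def by blast
    qed
  qed
  thus ?thesis by (simp add: V_def)
qed

section \<open>Degree sum, polygons and nonsimple facets\<close>

lemma sum_degrees:
  fixes P :: "'a::euclidean_space set"
  assumes P: "polytope P"
  shows "(\<Sum>v\<in>vertices_of P. card (nbrs P v)) = 2 * card (edges_of P)"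
proof -
  define S where "S = (SIGMA v:vertices_of P. nbrs P v)"
  define h where "h = (\<lambda>(v::'a, w). closed_segment v w)"
  have fN: "finite (nbrs P v)" for v
    using nbrs_vertices finite_vertices[OF P] by (meson finite_subset subsetI)
  have fS: "finite S" unfolding S_def using finite_vertices[OF P] fN by simp
  have img: "h ` S = edges_of P"
  proof
    show "h ` S \<subseteq> edges_of P"
    proof
      fix e assume "e \<in> h ` S"
      then obtain v w where "w \<in> nbrs P v" "e = closed_segment v w" by (auto simp: S_def h_def)
      moreover have "aff_dim (closed_segment v w) = (if v = w then 0 else 1)"
        using aff_dim_simplex[OF simplex_segment_cases] .
      ultimately show "e \<in> edges_of P" unfolding edges_of_def nbrs_def by auto
    qed
    show "edges_of P \<subseteq> h ` S"
    proof
      fix e assume "e \<in> edges_of P"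
      hence e: "e face_of P" "aff_dim e = 1" by (auto simp: edges_of_def)
      then obtain u w where uw: "u \<noteq> w" "e = closed_segment u w"
        using polytope_aff_dim_1 face_of_polytope_polytope[OF P] by metis
      hence "w \<in> nbrs P u" using e by (auto simp: nbrs_def)
      hence "(u, w) \<in> S" using nbrs_vertices by (auto simp: S_def)
      thus "e \<in> h ` S" using uw by (force simp: h_def)
    qed
  qed
  have fib: "card {x \<in> S. h x = e} = 2" if "e \<in> h ` S" for e
  proof -
    obtain u w where uw: "(u, w) \<in> S" "e = closed_segment u w" using \<open>e \<in> h ` S\<close> by (auto simp: h_def)
    have "w \<in> nbrs P u" using uw by (auto simp: S_def)
    hence "u \<in> nbrs P w" "w \<in> vertices_of P" by (auto intro: nbrs_sym nbrs_vertices)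
    moreover from this have "u \<noteq> w" by (simp add: nbrs_def)
    ultimately have wu: "(w, u) \<in> S" "h (w, u) = e" "h (u, w) = e" "u \<noteq> w"
      using uw(2) closed_segment_commute[of w u] by (simp_all add: h_def S_def)
    have "x = (u, w) \<or> x = (w, u)" if "h x = e" for x
      using that uw(2) unfolding h_def by (cases x) (simp add: doubleton_eq_iff)
    hence "{x \<in> S. h x = e} = {(u, w), (w, u)}" using uw(1) wu by blast
    thus ?thesis using wu(4) by simp
  qed
  have "(\<Sum>v\<in>vertices_of P. card (nbrs P v)) = card S"
    unfolding S_def using finite_vertices[OF P] fN by simp
  also have "\<dots> = (\<Sum>e\<in>h ` S. card {x \<in> S. h x = e})"
    using sum.image_gen[OF fS, of "\<lambda>_. 1::nat" h] by simp
  also have "\<dots> = 2 * card (edges_of P)" using fib img by simp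
  finally show ?thesis .
qed

text \<open>Three neighbours and \<open>v\<close> lie in a plane and so satisfy an affine relation
  with coefficients \<open>U\<close>. For each edge at \<open>v\<close>, an affine function that
  vanishes on the edge and is positive at the other two neighbours is applied to the relation: their
  coefficients have opposite signs or both vanish. Three numbers cannot have pairwise opposite
  signs, so all coefficients are 0.\<close>

lemma polygon_degree_le:
  fixes P :: "'a::euclidean_space set"
  assumes P: "polytope P" and dim: "aff_dim P = 2"
  shows "card (nbrs P v) \<le> 2"
proof (rule ccontr)
  assume "\<not> ?thesis"
  hence "3 \<le> card (nbrs P v)" by simp
  then obtain T where T: "T \<subseteq> nbrs P v" "card T = 3" by (meson obtain_subset_with_card_n)
  have fT: "finite T" using T(2) card.infinite by fastforce
  have "nbrs P v \<noteq> {}" using T by auto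
  then have vP: "v \<in> P" using nbrs_vertices(1) vertices_subset by blast
  have TP: "T \<subseteq> P" using T(1) nbrs_vertices(2) vertices_subset by blast
  have vT: "v \<notin> T" using T(1) by (auto simp: nbrs_def)
  have "aff_dim (insert v T) \<le> 2" using aff_dim_subset[of "insert v T" P] vP TP dim by simp
  hence "affine_dependent (insert v T)"
    using affine_independent_iff_card[of "insert v T"] fT vT T(2) by auto
  then obtain U where U: "sum U (insert v T) = 0" "\<exists>x\<in>insert v T. U x \<noteq> 0"
      "(\<Sum>x\<in>insert v T. U x *\<^sub>R x) = 0"
    using affine_dependent_explicit_finite[of "insert v T"] fT by auto
  have rel: "\<exists>f. (\<forall>x\<in>T - {w}. f x > (0::real)) \<and> (\<Sum>x\<in>T - {w}. U x * f x) = 0" if w: "w \<in> T" for w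
  proof -
    have face: "closed_segment v w face_of P" using w T(1) by (auto simp: nbrs_def)
    obtain a b where ab: "P \<subseteq> {x. a \<bullet> x \<le> b}" "closed_segment v w = P \<inter> {x. a \<bullet> x = b}"
      using face exposed_face_of_polyhedron[OF polytope_imp_polyhedron[OF P]]
      unfolding exposed_face_of_def by blast
    define f where "f x = b - a \<bullet> x" for x
    have "v \<in> closed_segment v w" "w \<in> closed_segment v w" by auto
    hence f0: "f v = 0" "f w = 0" using ab(2) by (auto simp: f_def)
    have "f x > 0" if x: "x \<in> T - {w}" for x
    proof -
      have "x \<in> vertices_of P" "x \<in> P" using x T(1) nbrs_vertices(2) TP by blast+
      moreover have "x \<noteq> v" "x \<noteq> w" using x vT by blast+
      ultimately have "x \<notin> closed_segment v w"
        using vertices_of_face[OF face] vertices_of_segment[of v w] by blast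
      hence "a \<bullet> x \<noteq> b" "a \<bullet> x \<le> b" using ab \<open>x \<in> P\<close> by auto
      thus ?thesis by (simp add: f_def)
    qed
    moreover have "(\<Sum>x\<in>T - {w}. U x * f x) = 0"
    proof -
      have "(\<Sum>x\<in>insert v T. U x * f x) = b * sum U (insert v T) - a \<bullet> (\<Sum>x\<in>insert v T. U x *\<^sub>R x)"
        unfolding f_def inner_sum_right sum_distrib_left sum_subtractf[symmetric]
        by (intro sum.cong) (auto simp: algebra_simps)
      hence "(\<Sum>x\<in>insert v T. U x * f x) = 0" using U by simp
      thus ?thesis using f0 fT vT w sum.remove[OF fT w, of "\<lambda>x. U x * f x"] by simp
    qed
    ultimately show ?thesis by blast
  qed
  obtain x y z where xyz: "T = {x, y, z}" "x \<noteq> y" "x \<noteq> z" "y \<noteq> z"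
    using T(2) card_3_iff by metis
  have opp: "\<exists>p q. p > 0 \<and> q > 0 \<and> U s * p + U t * q = (0::real)"
    if "T - {w} = {s, t}" "s \<noteq> t" "w \<in> T" for w s t
    using rel[OF that(3)] that(1,2) by auto
  have sgn: "U s * U t < 0 \<or> U s = 0 \<and> U t = 0" if st: "T - {w} = {s, t}" "s \<noteq> t" "w \<in> T" for w s t
  proof -
    obtain p q where pq: "p > 0" "q > 0" "U s * p + U t * q = 0" using opp[OF st] by blast
    hence Us: "U s = - (U t * q / p)" by (simp add: field_simps)
    show ?thesis
    proof (cases "U t = 0")
      case False
      hence "U t * U t > 0" using not_real_square_gt_zero by blast
      hence "U t * U t * (q / p) > 0" using pq by (simp add: zero_less_mult_iff)
      thus ?thesis unfolding Us by (simp add: algebra_simps)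
    qed (use Us in simp)
  qed
  have del: "T - {z} = {x, y}" "T - {y} = {x, z}" "T - {x} = {y, z}" "x \<in> T" "y \<in> T" "z \<in> T"
    using xyz by auto
  have "U x * U y < 0 \<or> U x = 0 \<and> U y = 0" "U x * U z < 0 \<or> U x = 0 \<and> U z = 0"
    "U y * U z < 0 \<or> U y = 0 \<and> U z = 0"
    using sgn[OF del(1) xyz(2) del(6)] sgn[OF del(2) xyz(3) del(5)] sgn[OF del(3) xyz(4) del(4)] .
  hence "U x = 0 \<and> U y = 0 \<and> U z = 0" by (auto simp: mult_less_0_iff)
  moreover from this have "U v = 0" using U(1) vT fT xyz by simp
  ultimately show False using U(2) xyz(1) by auto
qed

text \<open>The facet is itself a polytope, with \<open>nbrs F v = nbrs P v \<inter> F\<close>, so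
  the locale is interpreted for it with \<open>d - 1\<close> and \<open>no_small_simple\<close>
  applies one dimension lower.\<close>

lemma facet_not_simple:
  fixes P :: "'a::euclidean_space set"
  assumes P: "polytope P" and dim: "aff_dim P = int d"
    and K: "K \<in> facet_sets P" and lo: "d < card K" and hi: "card K < 2 * (d - 1)"
  shows "\<exists>v\<in>K. card (nbrs P v \<inter> K) \<noteq> d - 1"
proof (rule ccontr)
  assume neg: "\<not> ?thesis"
  obtain F where F: "F facet_of P" "K = vertices_of P \<inter> F" using K unfolding facet_sets_def by blast
  have face: "F face_of P" using F facet_of_imp_face_of by blast
  have VF: "vertices_of F = K" using vertices_of_face[OF face] F by simp
  have "aff_dim F = int (d - 1)" using F(1) dim hi by (simp add: facet_of_def of_nat_diff)
  then interpret F: polytope_graph "vertices_of F" "nbrs F" "facet_sets F" "d - 1"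
    using polytope_graph_of_polytope face_of_polytope_polytope[OF P face] by blast
  have "card (nbrs F v) = d - 1" if v: "v \<in> vertices_of F" for v
  proof -
    have "nbrs F v = nbrs P v \<inter> F" using nbrs_face[OF face] v VF F(2) by blast
    also have "\<dots> = nbrs P v \<inter> K" using nbrs_vertices F(2) by blast
    finally show ?thesis using neg v VF by simp
  qed
  thus False using F.no_small_simple VF lo hi by simp
qed

lemma prism_facets:
  fixes P :: "'a::euclidean_space set"
  assumes P: "polytope P" and dim: "aff_dim P = int d" and d: "2 \<le> d" "d \<noteq> 3"
    and cV: "card (vertices_of P) = 2 * d" and cE: "card (edges_of P) \<le> d ^ 2 + 1"
  shows "card (edges_of P) = d ^ 2 \<and> (\<exists>A f. A \<in> facet_sets P \<and> card A = d \<and>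
    bij_betw f A (vertices_of P - A) \<and>
    facet_sets P = {A, vertices_of P - A} \<union> (\<lambda>a. vertices_of P - {a, f a}) ` A)"
proof -
  interpret polytope_graph "vertices_of P" "nbrs P" "facet_sets P" d
    using polytope_graph_of_polytope[OF P dim] .
  have "(\<Sum>v\<in>vertices_of P. excess v) = int (\<Sum>v\<in>vertices_of P. card (nbrs P v)) - 2 * int d * int d"
    unfolding excess_def sum_subtractf using cV by simp
  also have "\<dots> = 2 * int (card (edges_of P)) - 2 * int d * int d" using sum_degrees[OF P] by simp
  also have "\<dots> \<le> 2"
  proof -
    have "int (card (edges_of P)) \<le> int d * int d + 1"
      using cE by (metis (mono_tags) of_nat_1 of_nat_add of_nat_le_iff of_nat_mult power2_eq_square)
    thus ?thesis by simp
  qed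
  finally have ex: "(\<Sum>v\<in>vertices_of P. excess v) \<le> 2" .
  have simple: "(\<exists>A\<in>facet_sets P. card A = d) \<and> (\<forall>v\<in>vertices_of P. card (nbrs P v) = d)"
  proof (cases "d = 2")
    case True
    have V2: "2 \<le> card (vertices_of P)" using cV True by simp
    have deg: "card (nbrs P v) = d" if "v \<in> vertices_of P" for v
      using polygon_degree_le[OF P] dim True degree_ge[OF that V2] by (simp add: le_antisym)
    obtain u v where "u \<in> vertices_of P" "v \<in> vertices_of P" "u \<noteq> v"
      using V2 card_le_Suc0_iff_eq[OF finite_V] by (auto simp: not_less_eq_eq numeral_2_eq_2)
    then obtain A where A: "A \<in> facet_sets P" using vertex_facet by blast
    have fA: "finite A" and AV: "A \<subset> vertices_of P" using finite_facet[OF A] facet_proper[OF A] by auto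
    have "card A < 4" using psubset_card_mono[OF finite_V AV] cV True by simp
    \<comment> \<open>The fourth vertex would be an apex of degree 3, but all degrees are 2.\<close>
    moreover have "card A \<noteq> 3"
    proof
      assume "card A = 3"
      hence "card (vertices_of P - A) = 1" using card_Diff_subset[OF fA] AV cV True by auto
      then obtain x where x: "vertices_of P - A = {x}" by (metis card_1_singletonE)
      hence "nbrs P x = A" using apex[OF A] by blast
      moreover have "x \<in> vertices_of P" using x by blast
      ultimately show False using deg[of x] \<open>card A = 3\<close> True by simp
    qed
    ultimately have "card A = d" using card_facet_ge[OF A] True by simp
    thus ?thesis using A deg by blast
  next
    case False
    hence d4: "4 \<le> d" using d by simp
    obtain A where "A \<in> facet_sets P" "card A = d"
      using simplex_facet_exists[OF d4 cV ex facet_not_simple[OF P dim]] by blast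
    thus ?thesis using simplex_facet_imp_simple[OF d4 cV ex] by blast
  qed
  then obtain A where A: "A \<in> facet_sets P" "card A = d" by blast
  have s: "card (nbrs P v) = d" if "v \<in> vertices_of P" for v using simple that by blast
  have "2 * card (edges_of P) = 2 * d ^ 2"
    using sum_degrees[OF P] s cV by (simp add: power2_eq_square)
  moreover obtain f where "bij_betw f A (vertices_of P - A)"
    "facet_sets P = {A, vertices_of P - A} \<union> (\<lambda>a. vertices_of P - {a, f a}) ` A"
    using simple_imp_prism_facets[OF s d(1) cV A] by blast
  ultimately show ?thesis using A by auto
qed

section \<open>Combinatorial equivalence with the prism\<close>

text \<open>A face is the hull of its vertices, so inclusion of faces is inclusion of vertex sets,
  and a vertex bijection that respects these sets in both directions induces the lattice
  isomorphism.\<close>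

lemma comb_equivI:
  fixes P :: "'a::euclidean_space set" and Q :: "'b::euclidean_space set"
  assumes P: "polytope P" and Q: "polytope Q"
    and g: "bij_betw g (vertices_of P) (vertices_of Q)"
    and faces: "\<And>X. X \<subseteq> vertices_of P \<Longrightarrow>
      (\<exists>F. F face_of P \<and> X = vertices_of P \<inter> F) \<longleftrightarrow> (\<exists>G. G face_of Q \<and> g ` X = vertices_of Q \<inter> G)"
  shows "comb_equiv P Q"
proof -
  define f where "f F = convex hull (g ` (vertices_of P \<inter> F))" for F
  have f: "f F face_of Q" "vertices_of Q \<inter> f F = g ` (vertices_of P \<inter> F)" if "F face_of P" for F
  proof -
    obtain G where G: "G face_of Q" "g ` (vertices_of P \<inter> F) = vertices_of Q \<inter> G"
      using faces[of "vertices_of P \<inter> F"] \<open>F face_of P\<close> by blast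
    hence "f F = G" unfolding f_def using face_hull_vertices[OF Q G(1)] by simp
    thus "f F face_of Q" "vertices_of Q \<inter> f F = g ` (vertices_of P \<inter> F)" using G by auto
  qed
  have sub: "F \<subseteq> F' \<longleftrightarrow> f F \<subseteq> f F'" if F: "F face_of P" "F' face_of P" for F F'
  proof -
    have "F \<subseteq> F' \<longleftrightarrow> vertices_of P \<inter> F \<subseteq> vertices_of P \<inter> F'"
      using face_hull_vertices[OF P F(1)] face_hull_vertices[OF P F(2)] hull_mono
      by (metis Int_mono subset_refl)
    also have "\<dots> \<longleftrightarrow> g ` (vertices_of P \<inter> F) \<subseteq> g ` (vertices_of P \<inter> F')"
      using g by (intro inj_on_image_subset_iff[symmetric, of g "vertices_of P"]) (auto simp: bij_betw_def)
    also have "\<dots> \<longleftrightarrow> f F \<subseteq> f F'"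
      using f[OF F(1)] f[OF F(2)] hull_mono unfolding f_def by (metis Int_mono subset_refl)
    finally show ?thesis .
  qed
  have "bij_betw f {F. F face_of P} {G. G face_of Q}"
    unfolding bij_betw_def
  proof
    show "inj_on f {F. F face_of P}"
      by (rule inj_onI) (metis sub mem_Collect_eq subset_antisym subset_refl)
    show "f ` {F. F face_of P} = {G. G face_of Q}"
    proof
      show "f ` {F. F face_of P} \<subseteq> {G. G face_of Q}" using f by blast
      show "{G. G face_of Q} \<subseteq> f ` {F. F face_of P}"
      proof
        fix G assume "G \<in> {G. G face_of Q}"
        hence G: "G face_of Q" by simp
        define X where "X = {v \<in> vertices_of P. g v \<in> G}"
        have gV: "g ` vertices_of P = vertices_of Q" using g by (simp add: bij_betw_def)
        have X: "g ` X = vertices_of Q \<inter> G" unfolding X_def gV[symmetric] by blast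
        moreover have "X \<subseteq> vertices_of P" unfolding X_def by blast
        ultimately obtain F where F: "F face_of P" "X = vertices_of P \<inter> F" using faces G by blast
        have "f F = G" unfolding f_def using F(2) X face_hull_vertices[OF Q G] by simp
        thus "G \<in> f ` {F. F face_of P}" using F by blast
      qed
    qed
  qed
  thus ?thesis unfolding comb_equiv_def using sub by blast
qed

lemma face_vertices_iff_Inter_facets:
  fixes P :: "'a::euclidean_space set"
  assumes P: "polytope P"
  shows "(\<exists>F. F face_of P \<and> X = vertices_of P \<inter> F) \<longleftrightarrow>
    X = {} \<or> (\<exists>\<K>\<subseteq>facet_sets P. X = vertices_of P \<inter> \<Inter>\<K>)"
proof
  assume "\<exists>F. F face_of P \<and> X = vertices_of P \<inter> F"
  then obtain F where F: "F face_of P" "X = vertices_of P \<inter> F" by blast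
  show "X = {} \<or> (\<exists>\<K>\<subseteq>facet_sets P. X = vertices_of P \<inter> \<Inter>\<K>)"
  proof (cases "F = {} \<or> F = P")
    case True
    thus ?thesis
    proof
      assume "F = P"
      hence "X = vertices_of P \<inter> \<Inter>{}" using F vertices_subset by auto
      thus ?thesis by blast
    qed (use F in simp)
  next
    case False
    hence eq: "F = \<Inter>{K. K facet_of P \<and> F \<subseteq> K}"
      using face_of_polyhedron[OF polytope_imp_polyhedron[OF P] F(1)] by blast
    define \<K> where "\<K> = (\<lambda>K. vertices_of P \<inter> K) ` {K. K facet_of P \<and> F \<subseteq> K}"
    have "\<K> \<subseteq> facet_sets P" unfolding \<K>_def facet_sets_def by blast
    moreover have "vertices_of P \<inter> \<Inter>{K. K facet_of P \<and> F \<subseteq> K} = vertices_of P \<inter> \<Inter>\<K>"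
      unfolding \<K>_def by blast
    hence "X = vertices_of P \<inter> \<Inter>\<K>" using F(2) eq by simp
    ultimately show ?thesis by blast
  qed
next
  assume "X = {} \<or> (\<exists>\<K>\<subseteq>facet_sets P. X = vertices_of P \<inter> \<Inter>\<K>)"
  thus "\<exists>F. F face_of P \<and> X = vertices_of P \<inter> F"
  proof
    assume "X = {}"
    thus ?thesis by (intro exI[of _ "{}"]) simp
  next
    assume "\<exists>\<K>\<subseteq>facet_sets P. X = vertices_of P \<inter> \<Inter>\<K>"
    then obtain \<K> where K: "\<K> \<subseteq> facet_sets P" "X = vertices_of P \<inter> \<Inter>\<K>" by blast
    \<comment> \<open>\<open>P\<close> is inserted so that an empty family yields \<open>P\<close>
      and not the whole space.\<close>
    define \<G> where "\<G> = insert P {G. G facet_of P \<and> vertices_of P \<inter> G \<in> \<K>}"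
    have "\<Inter>\<G> face_of P"
    proof (rule face_of_Inter)
      show "\<G> \<noteq> {}" by (simp add: \<G>_def)
      show "T face_of P" if "T \<in> \<G>" for T
        using that face_of_refl[OF polytope_imp_convex[OF P]] facet_of_imp_face_of unfolding \<G>_def by blast
    qed
    moreover have "X = vertices_of P \<inter> \<Inter>\<G>"
    proof
      show "X \<subseteq> vertices_of P \<inter> \<Inter>\<G>" using K(2) vertices_subset unfolding \<G>_def by blast
      show "vertices_of P \<inter> \<Inter>\<G> \<subseteq> X"
      proof
        fix x assume x: "x \<in> vertices_of P \<inter> \<Inter>\<G>"
        have "x \<in> k" if k: "k \<in> \<K>" for k
        proof -
          obtain G where G: "G facet_of P" "k = vertices_of P \<inter> G"
            using K(1) k unfolding facet_sets_def by blast
          hence "G \<in> \<G>" using k by (simp add: \<G>_def)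
          thus ?thesis using x G(2) by blast
        qed
        thus "x \<in> X" using K(2) x by blast
      qed
    qed
    ultimately show ?thesis by blast
  qed
qed

text \<open>Each facet \<open>V - {a, f a}\<close> in the family deletes one matched pair, and
  \<open>I\<close> collects the pairs that survive; \<open>A\<close> and \<open>V - A\<close>, if
  present, cut the result down to one side.\<close>

lemma Inter_prism_facets:
  assumes AV: "A \<subseteq> V" and f: "bij_betw f A (V - A)"
    and Fs: "Fs = {A, V - A} \<union> (\<lambda>a. V - {a, f a}) ` A"
  shows "X = {} \<or> (\<exists>\<K>\<subseteq>Fs. X = V \<inter> \<Inter>\<K>) \<longleftrightarrow> (\<exists>I\<subseteq>A. X = I \<or> X = f ` I \<or> X = I \<union> f ` I)"
proof
  have fB: "f a \<in> V" "f a \<notin> A" if "a \<in> A" for a using f that unfolding bij_betw_def by blast+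
  have inj: "f a = f a' \<longleftrightarrow> a = a'" if "a \<in> A" "a' \<in> A" for a a'
    using f that unfolding bij_betw_def by (auto dest: inj_onD)
  have V: "V = A \<union> f ` A" using f AV unfolding bij_betw_def by blast
  {
    assume "X = {} \<or> (\<exists>\<K>\<subseteq>Fs. X = V \<inter> \<Inter>\<K>)"
    thus "\<exists>I\<subseteq>A. X = I \<or> X = f ` I \<or> X = I \<union> f ` I"
    proof
      assume "\<exists>\<K>\<subseteq>Fs. X = V \<inter> \<Inter>\<K>"
      then obtain \<K> where K: "\<K> \<subseteq> Fs" "X = V \<inter> \<Inter>\<K>" by blast
      define I where "I = {a \<in> A. V - {a, f a} \<notin> \<K>}"
      have IA: "I \<subseteq> A" by (auto simp: I_def)
      have 1: "a \<in> X \<longleftrightarrow> V - A \<notin> \<K> \<and> a \<in> I" if a: "a \<in> A" for a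
      proof
        assume aX: "a \<in> X"
        show "V - A \<notin> \<K> \<and> a \<in> I" using aX a unfolding K(2) I_def by blast
      next
        assume *: "V - A \<notin> \<K> \<and> a \<in> I"
        have "a \<in> k" if "k \<in> \<K>" for k
        proof -
          have "k \<in> Fs" using K(1) that by blast
          then consider "k = A" | "k = V - A" | a' where "a' \<in> A" "k = V - {a', f a'}"
            unfolding Fs by blast
          thus ?thesis
          proof cases
            case 3
            hence "a \<noteq> a'" using * that unfolding I_def by blast
            moreover have "a \<noteq> f a'" using fB(2)[OF 3(1)] a by blast
            ultimately show ?thesis using 3 a AV by blast
          qed (use * that a in auto)
        qed
        thus "a \<in> X" using K(2) a AV by blast
      qed
      have 2: "f a \<in> X \<longleftrightarrow> A \<notin> \<K> \<and> a \<in> I" if a: "a \<in> A" for a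
      proof
        assume aX: "f a \<in> X"
        show "A \<notin> \<K> \<and> a \<in> I" using aX a fB(2)[OF a] unfolding K(2) I_def by blast
      next
        assume *: "A \<notin> \<K> \<and> a \<in> I"
        have "f a \<in> k" if "k \<in> \<K>" for k
        proof -
          have "k \<in> Fs" using K(1) that by blast
          then consider "k = A" | "k = V - A" | a' where "a' \<in> A" "k = V - {a', f a'}"
            unfolding Fs by blast
          thus ?thesis
          proof cases
            case 3
            hence "a \<noteq> a'" using * that unfolding I_def by blast
            hence "f a \<noteq> f a'" using inj 3 a by blast
            moreover have "f a \<noteq> a'" using fB(2)[OF a] 3 by blast
            ultimately show ?thesis using 3 fB[OF a] by blast
          qed (use * that fB[OF a] in auto)
        qed
        thus "f a \<in> X" using K(2) fB[OF a] by blast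
      qed
      have XV: "X \<subseteq> V" using K by blast
      have "X = (if V - A \<in> \<K> then {} else I) \<union> (if A \<in> \<K> then {} else f ` I)"
      proof (rule set_eqI)
        fix x
        show "x \<in> X \<longleftrightarrow> x \<in> (if V - A \<in> \<K> then {} else I) \<union> (if A \<in> \<K> then {} else f ` I)"
        proof (cases "x \<in> A")
          case True
          moreover have "x \<notin> f ` I" using True fB IA by blast
          ultimately show ?thesis using 1 by auto
        next
          case False
          show ?thesis
          proof (cases "x \<in> V")
            case True
            then obtain a where a: "a \<in> A" "x = f a" using V False by blast
            have "x \<in> f ` I \<longleftrightarrow> a \<in> I" using a inj IA by blast
            thus ?thesis using 2[OF a(1)] a(2) False IA by auto
          next
            case False
            thus ?thesis using XV IA AV fB by auto
          qed
        qed
      qed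
      thus ?thesis using IA by (cases "V - A \<in> \<K>"; cases "A \<in> \<K>") auto
    qed blast
  }
  {
    assume "\<exists>I\<subseteq>A. X = I \<or> X = f ` I \<or> X = I \<union> f ` I"
    then obtain I where I: "I \<subseteq> A" "X = I \<or> X = f ` I \<or> X = I \<union> f ` I" by blast
    define \<K> where "\<K> = (\<lambda>a. V - {a, f a}) ` (A - I)"
    have KF: "\<K> \<subseteq> Fs" unfolding \<K>_def Fs by blast
    have VK: "V \<inter> \<Inter>\<K> = I \<union> f ` I"
    proof
      show "V \<inter> \<Inter>\<K> \<subseteq> I \<union> f ` I" unfolding \<K>_def using V by blast
      show "I \<union> f ` I \<subseteq> V \<inter> \<Inter>\<K>"
        unfolding \<K>_def using V I(1) fB inj by blast
    qed
    have fI: "f ` I \<subseteq> V - A" using I(1) fB by blast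
    have "V \<inter> \<Inter>(insert A \<K>) = (V \<inter> \<Inter>\<K>) \<inter> A" by blast
    also have "\<dots> = I" unfolding VK using I(1) fI by blast
    finally have "V \<inter> \<Inter>(insert A \<K>) = I" .
    moreover have "V \<inter> \<Inter>(insert (V - A) \<K>) = (V \<inter> \<Inter>\<K>) \<inter> (V - A)" by blast
    hence "V \<inter> \<Inter>(insert (V - A) \<K>) = f ` I" unfolding VK using I(1) fI by blast
    moreover have "insert A \<K> \<subseteq> Fs" "insert (V - A) \<K> \<subseteq> Fs" using KF Fs by auto
    ultimately have "\<exists>\<K>\<subseteq>Fs. X = V \<inter> \<Inter>\<K>" using I(2) KF VK by metis
    thus "X = {} \<or> (\<exists>\<K>\<subseteq>Fs. X = V \<inter> \<Inter>\<K>)" by blast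
  }
qed

section \<open>The prism as a product of a segment and a simplex\<close>

lemma segment_plus_simplex:
  fixes A :: "'a::euclidean_space set" and n v :: 'a
  assumes indep: "\<not> affine_dependent A" and nA: "\<And>a. a \<in> A \<Longrightarrow> n \<bullet> a = c" and nv: "n \<bullet> v \<noteq> 0"
  defines "Q \<equiv> {x + y | x y. x \<in> closed_segment 0 v \<and> y \<in> convex hull A}"
  shows "polytope Q" "vertices_of Q = A \<union> (\<lambda>a. a + v) ` A"
    "(\<exists>G. G face_of Q \<and> X = vertices_of Q \<inter> G) \<longleftrightarrow>
       (\<exists>I\<subseteq>A. X = I \<or> X = (\<lambda>a. a + v) ` I \<or> X = I \<union> (\<lambda>a. a + v) ` I)"
proof -
  \<comment> \<open>\<open>t\<close> is the coordinate along \<open>v\<close>, with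
    \<open>t v = 1\<close>; \<open>t0\<close> is its constant value on \<open>A\<close>, and
    \<open>sh\<close> pushes \<open>A\<close> along \<open>v\<close> into the hyperplane
    \<open>t = 0\<close>.\<close>
  define t where "t x = (n \<bullet> x) / (n \<bullet> v)" for x
  define t0 where "t0 = c / (n \<bullet> v)"
  \<comment> \<open>\<open>\<phi>\<close> identifies \<open>Q\<close> with a product, whose faces are products of faces.\<close>
  define \<phi> where "\<phi> x = (t x, x - t x *\<^sub>R v)" for x
  define \<psi> where "\<psi> = (\<lambda>(s, y). y + s *\<^sub>R v)"
  define S where "S = closed_segment t0 (t0 + 1)"
  define sh where "sh a = a - t0 *\<^sub>R v" for a
  have fA: "finite A" using indep aff_independent_finite by blast
  have shA: "\<not> affine_dependent (sh ` A)"
    using indep affine_dependent_translation_eq[of A "- (t0 *\<^sub>R v)"] unfolding sh_def by simp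
  have hull_sh: "convex hull (sh ` B) = sh ` (convex hull B)" for B
    using convex_hull_translation[of "- (t0 *\<^sub>R v)" B] unfolding sh_def by simp
  have inj_sh: "inj sh" unfolding sh_def by (rule injI) simp
  define T where "T = convex hull (sh ` A)"
  have tadd: "t (x + y) = t x + t y" "t (r *\<^sub>R x) = r * t x" "t v = 1" for x y r
    unfolding t_def using nv by (auto simp: inner_add_right add_divide_distrib)
  have lin\<phi>: "linear \<phi>"
    by (rule linearI) (auto simp: \<phi>_def tadd algebra_simps)
  have lin\<psi>: "linear \<psi>"
    by (rule linearI) (auto simp: \<psi>_def algebra_simps split: prod.splits)
  have \<psi>\<phi>: "\<psi> (\<phi> x) = x" for x by (simp add: \<psi>_def \<phi>_def)
  have inj\<phi>: "inj \<phi>" using \<psi>\<phi> by (metis injI)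
  have "convex hull A \<subseteq> {x. n \<bullet> x = c}"
    using nA by (intro hull_minimal) (auto simp: convex_hyperplane)
  hence tA: "t y = t0" if "y \<in> convex hull A" for y using that by (auto simp: t_def t0_def)
  have \<phi>sum: "\<phi> (s *\<^sub>R v + y) = (t0 + s, sh y)" if "y \<in> convex hull A" for s y
    unfolding \<phi>_def tadd tA[OF that] sh_def by (simp add: algebra_simps)
  have img: "\<phi> ` Q = S \<times> T"
  proof
    show "\<phi> ` Q \<subseteq> S \<times> T"
    proof
      fix z assume "z \<in> \<phi> ` Q"
      then obtain s y where s: "0 \<le> s" "s \<le> 1" "y \<in> convex hull A" "z = \<phi> (s *\<^sub>R v + y)"
        unfolding Q_def by (auto simp: in_segment)
      hence "z = (t0 + s, sh y)" using \<phi>sum by simp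
      moreover have "t0 + s \<in> S" unfolding S_def using s by (simp add: closed_segment_eq_real_ivl)
      ultimately show "z \<in> S \<times> T" unfolding T_def hull_sh using s by simp
    qed
    show "S \<times> T \<subseteq> \<phi> ` Q"
    proof
      fix z assume "z \<in> S \<times> T"
      then obtain r y where z: "z = (r, sh y)" "r \<in> S" "y \<in> convex hull A"
        unfolding T_def hull_sh by auto
      have r: "0 \<le> r - t0" "r - t0 \<le> 1" using z(2) unfolding S_def by (auto simp: closed_segment_eq_real_ivl)
      have "z = \<phi> ((r - t0) *\<^sub>R v + y)" using \<phi>sum[OF z(3)] z(1) by simp
      moreover have "(r - t0) *\<^sub>R v \<in> closed_segment 0 v" unfolding in_segment
        using r by (intro exI[of _ "r - t0"]) simp
      ultimately show "z \<in> \<phi> ` Q" unfolding Q_def using z(3) by blast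
    qed
  qed
  have poly: "polytope (S \<times> T)"
    unfolding S_def T_def segment_convex_hull using fA by (intro polytope_Times polytope_convex_hull) auto
  have "\<psi> ` \<phi> ` Q = Q" using \<psi>\<phi> by (simp add: image_image)
  thus "polytope Q" using polytope_linear_image[OF lin\<psi> poly] img by simp
  have face_iff: "G face_of Q \<longleftrightarrow> \<phi> ` G face_of S \<times> T" for G
    using face_of_linear_image[OF lin\<phi> inj\<phi>, of G Q] img by simp
  have \<phi>A: "\<phi> a = (t0, sh a)" "\<phi> (a + v) = (t0 + 1, sh a)" if "a \<in> A" for a
    using \<phi>sum[of a 0] \<phi>sum[of a 1] that by (simp_all add: hull_inc add.commute)
  have vert: "vertices_of Q = A \<union> (\<lambda>a. a + v) ` A"
  proof (rule set_eqI)
    fix x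
    have "x \<in> vertices_of Q \<longleftrightarrow> {x} face_of Q" by (simp add: vertices_of_def face_of_singleton)
    also have "\<dots> \<longleftrightarrow> {t x} \<times> {x - t x *\<^sub>R v} face_of S \<times> T" unfolding face_iff by (simp add: \<phi>_def)
    also have "\<dots> \<longleftrightarrow> t x extreme_point_of S \<and> (x - t x *\<^sub>R v) extreme_point_of T"
      unfolding face_of_Times_eq by (simp add: face_of_singleton)
    also have "\<dots> \<longleftrightarrow> (t x = t0 \<or> t x = t0 + 1) \<and> x - t x *\<^sub>R v \<in> sh ` A"
      unfolding S_def T_def extreme_point_of_segment
        extreme_point_of_convex_hull_affine_independent[OF shA] ..
    also have "\<dots> \<longleftrightarrow> x \<in> A \<union> (\<lambda>a. a + v) ` A"
    proof
      assume *: "(t x = t0 \<or> t x = t0 + 1) \<and> x - t x *\<^sub>R v \<in> sh ` A"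
      then obtain a where a: "a \<in> A" "x - t x *\<^sub>R v = a - t0 *\<^sub>R v" unfolding sh_def by blast
      hence "x = a + (t x - t0) *\<^sub>R v" by (simp add: algebra_simps)
      thus "x \<in> A \<union> (\<lambda>a. a + v) ` A" using * a(1) by auto
    next
      assume "x \<in> A \<union> (\<lambda>a. a + v) ` A"
      thus "(t x = t0 \<or> t x = t0 + 1) \<and> x - t x *\<^sub>R v \<in> sh ` A"
        using \<phi>A unfolding \<phi>_def by auto
    qed
    finally show "x \<in> vertices_of Q \<longleftrightarrow> x \<in> A \<union> (\<lambda>a. a + v) ` A" .
  qed
  show "vertices_of Q = A \<union> (\<lambda>a. a + v) ` A" by (rule vert)
  have inter: "vertices_of Q \<inter> G =
      (if t0 \<in> F1 then {a \<in> A. sh a \<in> F2} else {}) \<union> (if t0 + 1 \<in> F1 then (\<lambda>a. a + v) ` {a \<in> A. sh a \<in> F2} else {})"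
    if G: "\<phi> ` G = F1 \<times> F2" for G F1 F2
  proof -
    have "x \<in> G \<longleftrightarrow> \<phi> x \<in> F1 \<times> F2" for x using G inj\<phi> inj_image_mem_iff by metis
    hence "a \<in> G \<longleftrightarrow> t0 \<in> F1 \<and> sh a \<in> F2" "a + v \<in> G \<longleftrightarrow> t0 + 1 \<in> F1 \<and> sh a \<in> F2" if "a \<in> A" for a
      using \<phi>A[OF that] by auto
    thus ?thesis unfolding vert by auto
  qed
  show "(\<exists>G. G face_of Q \<and> X = vertices_of Q \<inter> G) \<longleftrightarrow>
       (\<exists>I\<subseteq>A. X = I \<or> X = (\<lambda>a. a + v) ` I \<or> X = I \<union> (\<lambda>a. a + v) ` I)"
  proof
    assume "\<exists>G. G face_of Q \<and> X = vertices_of Q \<inter> G"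
    then obtain G where G: "G face_of Q" "X = vertices_of Q \<inter> G" by blast
    then obtain F1 F2 where F: "\<phi> ` G = F1 \<times> F2"
      using face_iff face_of_Times_decomp[of "\<phi> ` G" S T] by blast
    define I where "I = {a \<in> A. sh a \<in> F2}"
    have "I \<subseteq> A" by (auto simp: I_def)
    moreover have "X = (if t0 \<in> F1 then I else {}) \<union> (if t0 + 1 \<in> F1 then (\<lambda>a. a + v) ` I else {})"
      using G(2) inter[OF F] unfolding I_def by simp
    ultimately show "\<exists>I\<subseteq>A. X = I \<or> X = (\<lambda>a. a + v) ` I \<or> X = I \<union> (\<lambda>a. a + v) ` I"
      by (cases "t0 \<in> F1"; cases "t0 + 1 \<in> F1") auto
  next
    assume "\<exists>I\<subseteq>A. X = I \<or> X = (\<lambda>a. a + v) ` I \<or> X = I \<union> (\<lambda>a. a + v) ` I"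
    then obtain I where I: "I \<subseteq> A" "X = I \<or> X = (\<lambda>a. a + v) ` I \<or> X = I \<union> (\<lambda>a. a + v) ` I" by blast
    define F2 where "F2 = convex hull (sh ` I)"
    have F2T: "F2 face_of T"
      unfolding T_def F2_def face_of_convex_hull_affine_independent[OF shA] using I(1) by blast
    have IF2: "{a \<in> A. sh a \<in> F2} = I"
    proof
      show "I \<subseteq> {a \<in> A. sh a \<in> F2}" unfolding F2_def using I(1) by (auto intro: hull_inc)
      show "{a \<in> A. sh a \<in> F2} \<subseteq> I"
      proof
        fix a assume "a \<in> {a \<in> A. sh a \<in> F2}"
        hence a: "a \<in> A" "sh a \<in> F2" by auto
        have "sh a extreme_point_of T"
          unfolding T_def extreme_point_of_convex_hull_affine_independent[OF shA] using a by blast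
        hence "sh a extreme_point_of F2" using extreme_point_of_face[OF F2T] a by blast
        hence "sh a \<in> sh ` I" unfolding F2_def by (rule extreme_point_of_convex_hull)
        thus "a \<in> I" using inj_sh inj_image_mem_iff by metis
      qed
    qed
    have mk: "\<exists>G. G face_of Q \<and> \<phi> ` G = F1 \<times> F2" if F1: "F1 face_of S" for F1
    proof -
      have face: "F1 \<times> F2 face_of S \<times> T" using F1 F2T by (rule face_of_Times)
      hence "F1 \<times> F2 \<subseteq> \<phi> ` Q" using face_of_imp_subset img by blast
      then obtain G where "\<phi> ` G = F1 \<times> F2" by (metis subset_imageE)
      thus ?thesis using face_iff face by metis
    qed
    have seg: "{t0} face_of S" "{t0 + 1} face_of S" "S face_of S"
      unfolding S_def by (auto simp: face_of_singleton extreme_point_of_segment face_of_refl)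
    have "t0 \<in> S" "t0 + 1 \<in> S" unfolding S_def by auto
    \<comment> \<open>The lower end, the upper end and the whole segment produce the three shapes of
      \<open>X\<close>.\<close>
    have "\<exists>F1. F1 face_of S \<and>
      X = (if t0 \<in> F1 then I else {}) \<union> (if t0 + 1 \<in> F1 then (\<lambda>a. a + v) ` I else {})"
      using I(2)
    proof (elim disjE)
      assume "X = I" thus ?thesis using seg(1) by (intro exI[of _ "{t0}"]) auto
    next
      assume "X = (\<lambda>a. a + v) ` I" thus ?thesis using seg(2) by (intro exI[of _ "{t0 + 1}"]) auto
    next
      assume "X = I \<union> (\<lambda>a. a + v) ` I"
      thus ?thesis using seg(3) \<open>t0 \<in> S\<close> \<open>t0 + 1 \<in> S\<close> by (intro exI[of _ S]) auto
    qed
    then obtain F1 where F1: "F1 face_of S"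
      "X = (if t0 \<in> F1 then I else {}) \<union> (if t0 + 1 \<in> F1 then (\<lambda>a. a + v) ` I else {})" by blast
    obtain G where G: "G face_of Q" "\<phi> ` G = F1 \<times> F2" using mk[OF F1(1)] by blast
    have "X = vertices_of Q \<inter> G" using inter[OF G(2)] F1(2) IF2 by simp
    thus "\<exists>G. G face_of Q \<and> X = vertices_of Q \<inter> G" using G by blast
  qed
qed

section \<open>Comparison of the polytope with a model prism\<close>

text \<open>The model prism is erected over the facet spanned by \<open>A\<close>, which is a
  simplex because its \<open>d\<close> vertices span dimension \<open>d - 1\<close>. Both vertex
  families of faces then have the shape \<open>I\<close>, its partner set, or their union.\<close>

lemma prism_facets_imp_comb_equiv:
  fixes P :: "'a::euclidean_space set"
  assumes P: "polytope P" and dim: "aff_dim P = int d" and d: "1 \<le> d"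
    and A: "A \<in> facet_sets P" "card A = d" and f: "bij_betw f A (vertices_of P - A)"
    and Fs: "facet_sets P = {A, vertices_of P - A} \<union> (\<lambda>a. vertices_of P - {a, f a}) ` A"
  shows "\<exists>Q::'a set. simplicial_prism d Q \<and> comb_equiv P Q"
proof -
  define V where "V = vertices_of P"
  obtain K where K: "K facet_of P" "A = V \<inter> K" using A(1) unfolding facet_sets_def V_def by blast
  have Kf: "K face_of P" using K facet_of_imp_face_of by blast
  have hullA: "convex hull A = K" using face_hull_vertices[OF P Kf] K V_def by simp
  have AV: "A \<subseteq> V" using K by blast
  have fA: "finite A" using finite_vertices[OF P] AV V_def finite_subset by blast
  have "aff_dim A = int d - 1"
    using K(1) dim hullA aff_dim_convex_hull[of A] by (simp add: facet_of_def)
  hence indep: "\<not> affine_dependent A" using affine_independent_iff_card[of A] fA A(2) by simp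
  obtain n c where n: "P \<subseteq> {x. n \<bullet> x \<le> c}" "K = P \<inter> {x. n \<bullet> x = c}"
    using Kf exposed_face_of_polyhedron[OF polytope_imp_polyhedron[OF P]]
    unfolding exposed_face_of_def by blast
  have nA: "n \<bullet> a = c" if "a \<in> A" for a using that K n by blast
  have "A \<noteq> {}" using A(2) d by auto
  then obtain a where a: "a \<in> A" by blast
  have fa: "f a \<in> V" "f a \<notin> A" using f a unfolding bij_betw_def V_def by blast+
  have "f a \<notin> K" "f a \<in> P" using fa K vertices_subset V_def by blast+
  hence "n \<bullet> f a \<noteq> c" using n by blast
  \<comment> \<open>What matters is that \<open>v\<close> leaves the supporting hyperplane of
    \<open>K\<close>; any matched pair supplies such a vector.\<close>
  define v where "v = f a - a"
  have nv: "n \<bullet> v \<noteq> 0" using \<open>n \<bullet> f a \<noteq> c\<close> nA[OF a] by (simp add: v_def inner_diff_right)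
  define Q where "Q = {x + y | x y. x \<in> closed_segment 0 v \<and> y \<in> convex hull A}"
  note Q = segment_plus_simplex[OF indep nA nv, folded Q_def]
  have "span {v - 0} \<inter> span {x - y | x y. x \<in> convex hull A \<and> y \<in> convex hull A} = {0}"
  proof -
    have "span {x - y | x y. x \<in> convex hull A \<and> y \<in> convex hull A} \<subseteq> {x. n \<bullet> x = 0}"
    proof (rule span_minimal)
      show "subspace {x. n \<bullet> x = 0}" by (rule subspace_hyperplane)
      show "{x - y | x y. x \<in> convex hull A \<and> y \<in> convex hull A} \<subseteq> {x. n \<bullet> x = 0}"
        unfolding hullA n(2) by (auto simp: inner_diff_right)
    qed
    moreover have "x = 0" if x: "x \<in> span {v - 0}" "n \<bullet> x = 0" for x
    proof -
      obtain k where "x = k *\<^sub>R v" using x(1) by (auto simp: span_singleton)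
      thus ?thesis using x(2) nv by simp
    qed
    ultimately show ?thesis using span_zero by blast
  qed
  moreover have "(int d - 1) simplex (convex hull A)"
    unfolding simplex_def using indep A(2) by (intro exI[of _ A]) simp
  moreover have "(0::'a) \<noteq> v" using nv by auto
  ultimately have prism: "simplicial_prism d Q" unfolding simplicial_prism_def Q_def by blast
  define W where "W = vertices_of Q"
  have W: "W = A \<union> (\<lambda>a. a + v) ` A" unfolding W_def by (rule Q(2))
  \<comment> \<open>\<open>A\<close> is fixed pointwise, and the partner of \<open>a\<close> goes to
    the translate \<open>a + v\<close>.\<close>
  define g where "g x = (if x \<in> A then x else the_inv_into A f x + v)" for x
  have injf: "inj_on f A" and imgf: "f ` A = V - A" using f unfolding bij_betw_def V_def by auto
  have gA: "g x = x" if "x \<in> A" for x using that by (simp add: g_def)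
  have gf: "g (f x) = x + v" if "x \<in> A" for x
  proof -
    have "f x \<notin> A" using imgf that by blast
    thus ?thesis using the_inv_into_f_f[OF injf that] by (simp add: g_def)
  qed
  have gI: "g ` I = I" "g ` f ` I = (\<lambda>a. a + v) ` I" if "I \<subseteq> A" for I
    using that gA gf by (force simp: image_image)+
  have Vun: "V = A \<union> f ` A" using imgf AV by blast
  have notA: "x + v \<notin> A" if "x \<in> A" for x
    using nA[of "x + v"] nA[OF that] nv by (auto simp: inner_add_right)
  have injg: "inj_on g V"
  proof (rule inj_onI)
    fix x y assume xy: "x \<in> V" "y \<in> V" "g x = g y"
    consider "x \<in> A" "y \<in> A" | b where "x \<in> A" "b \<in> A" "y = f b" | b where "y \<in> A" "b \<in> A" "x = f b"
      | b b' where "b \<in> A" "b' \<in> A" "x = f b" "y = f b'"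
      using xy(1,2) unfolding Vun by blast
    thus "x = y"
    proof cases
      case 1 thus ?thesis using xy(3) gA by simp
    next
      case 2 thus ?thesis using xy(3) gA gf notA by metis
    next
      case 3 thus ?thesis using xy(3) gA gf notA by metis
    next
      case 4 thus ?thesis using xy(3) gf by simp
    qed
  qed
  have "g ` V = W" unfolding Vun W image_Un using gI[of A] by simp
  hence bij: "bij_betw g V W" using injg by (simp add: bij_betw_def)
  have "comb_equiv P Q"
  proof (rule comb_equivI[OF P Q(1)])
    show "bij_betw g (vertices_of P) (vertices_of Q)" using bij V_def W_def by simp
    fix X assume "X \<subseteq> vertices_of P"
    hence XV: "X \<subseteq> V" by (simp add: V_def)
    have "(\<exists>F. F face_of P \<and> X = vertices_of P \<inter> F) \<longleftrightarrow> (\<exists>I\<subseteq>A. X = I \<or> X = f ` I \<or> X = I \<union> f ` I)"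
      unfolding face_vertices_iff_Inter_facets[OF P]
      by (rule Inter_prism_facets[OF _ f Fs]) (use AV V_def in simp)
    also have "\<dots> \<longleftrightarrow> (\<exists>I\<subseteq>A. g ` X = I \<or> g ` X = (\<lambda>a. a + v) ` I \<or> g ` X = I \<union> (\<lambda>a. a + v) ` I)"
    proof -
      have eq: "X = Y \<longleftrightarrow> g ` X = g ` Y" if "Y \<subseteq> V" for Y
        using inj_on_image_eq_iff[OF injg XV that] by simp
      have "(X = I \<or> X = f ` I \<or> X = I \<union> f ` I) \<longleftrightarrow>
          (g ` X = I \<or> g ` X = (\<lambda>a. a + v) ` I \<or> g ` X = I \<union> (\<lambda>a. a + v) ` I)" if I: "I \<subseteq> A" for I
      proof -
        have sub: "I \<subseteq> V" "f ` I \<subseteq> V" "I \<union> f ` I \<subseteq> V" using I unfolding Vun by auto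
        show ?thesis
          unfolding eq[OF sub(1)] eq[OF sub(2)] eq[OF sub(3)] image_Un gI[OF I] ..
      qed
      thus ?thesis by (intro ex_cong1 conj_cong refl)
    qed
    also have "\<dots> \<longleftrightarrow> (\<exists>G. G face_of Q \<and> g ` X = vertices_of Q \<inter> G)" by (rule Q(3)[symmetric])
    finally show "(\<exists>F. F face_of P \<and> X = vertices_of P \<inter> F) \<longleftrightarrow>
        (\<exists>G. G face_of Q \<and> g ` X = vertices_of Q \<inter> G)" .
  qed
  thus ?thesis using prism by blast
qed

lemma segment_is_prism:
  fixes P :: "'a::euclidean_space set"
  assumes P: "polytope P" and dim: "aff_dim P = 1"
  shows "simplicial_prism 1 P \<and> comb_equiv P P \<and> card (edges_of P) = 1"
proof -
  obtain u w where uw: "u \<noteq> w" "P = closed_segment u w" using polytope_aff_dim_1[OF P dim] by blast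
  have "simplicial_prism 1 P"
    unfolding simplicial_prism_def
    \<comment> \<open>The simplex is the single point 0, of dimension \<open>int 1 - 1 = 0\<close>,
      so the Minkowski sum is the segment itself.\<close>
    by (rule exI[of _ u], rule exI[of _ w], rule exI[of _ "{0}"]) (use uw span_zero in auto)
  moreover have "comb_equiv P P"
    unfolding comb_equiv_def by (rule exI[of _ id]) auto
  moreover have "edges_of P = {P}"
  proof
    show "edges_of P \<subseteq> {P}"
      using face_of_aff_dim_lt[OF polytope_imp_convex[OF P]] dim unfolding edges_of_def by force
    show "{P} \<subseteq> edges_of P"
      using face_of_refl[OF polytope_imp_convex[OF P]] dim unfolding edges_of_def by simp
  qed
  ultimately show ?thesis by simp
qed

theorem theorem13:
  fixes P :: "'a::euclidean_space set" and d :: nat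
  assumes "polytope P"
    and "aff_dim P = int d"
    and "card (vertices_of P) = 2 * d"
    and "card (edges_of P) \<le> d ^ 2 + 1"
  shows "((\<exists>Q :: 'a set. simplicial_prism d Q \<and> comb_equiv P Q) \<and> card (edges_of P) = d ^ 2)
         \<or> d = 3"
proof -
  have "d \<noteq> 0"
  proof
    assume "d = 0"
    hence "vertices_of P = {}" using assms(3) finite_vertices[OF assms(1)] by simp
    hence "P = {}" using polytope_hull_vertices[OF assms(1)] by simp
    thus False using assms(2) by simp
  qed
  then consider "d = 1" | "2 \<le> d" "d \<noteq> 3" | "d = 3" by linarith
  thus ?thesis
  proof cases
    case 1
    thus ?thesis using segment_is_prism[OF assms(1)] assms(2) by auto
  next
    case 2
    obtain A f where "card (edges_of P) = d ^ 2" "A \<in> facet_sets P" "card A = d"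
      "bij_betw f A (vertices_of P - A)"
      "facet_sets P = {A, vertices_of P - A} \<union> (\<lambda>a. vertices_of P - {a, f a}) ` A"
      using prism_facets[OF assms(1,2) 2 assms(3,4)] by blast
    moreover have "1 \<le> d" using 2 by simp
    ultimately show ?thesis using prism_facets_imp_comb_equiv[OF assms(1,2)] by blast
  next
    case 3
    thus ?thesis by simp
  qed
qed

end
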